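(* For $n\in\mathbb{N}$, the joint Laplace transform $$\mathcal{L}^W_n(a,b)=\mathbb{E}_{\mu^W_n}\Big[e^{-\sum_{i\in V_n}(a_i^2+b_i^2-1)\beta_i^{V_n}-\sum_{i\in V_n}b_i\theta_i^{V_n}}\Big]$$ of $\beta^{V_n}=(\beta^{V_n}_i)_{i\in V_n}$ and $\theta^{V_n}=(\theta^{V_n}_i)_{i\in V_n}$ satisfies the consistency relation $$\mathcal{L}^W_n(a_{V_n},b_{V_n})=\mathcal{L}^W_{n+1}(a,b)$$ for all $[a,b]\in\mathcal{G}_{V_{n+1}}$ with $[a_i,b_i]=[1,0]$ for all $i\in\tilde V_{n+1}\setminus V_n$, where $a_{V_n},b_{V_n}$ are the restrictions of $a,b$ to $V_n$. In particular, the law of $(\beta^{V_n},\theta^{V_n})$ with respect to $\mu^W_n$ agrees with the law of the restriction to $V_n$, $(\beta^{V_{n+1}}_i,\theta^{V_{n+1}}_i)_{i\in V_n}$, with respect to $\mu^W_{n+1}$.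
   Context: Finite-volume model. Let $\tilde G=(\tilde V,\tilde E)$ be a finite connected undirected graph without loops or parallel edges, $\delta\in\tilde V$ a distinguished vertex, $V=\tilde V\setminus\{\delta\}$, with weights $W_{ij}=W_{ji}>0$ if $i\sim j$ and $W_{ij}=0$ otherwise. Let $\Omega_V=\{(u,s)\in\mathbb{R}^{\tilde V}\times\mathbb{R}^{\tilde V}:u_\delta=s_\delta=0\}$. Let $A^W(u)\in\mathbb{R}^{\tilde V\times\tilde V}$ have entries $-W_{ij}e^{u_i+u_j}$ for $i\neq j$ and $\sum_{k\in\tilde V}W_{ik}e^{u_i+u_k}$ for $i=j$, and let $A^W_{VV}(u)$ be its restriction to $V\times V$. The probability measure $\mu^W$ on $\Omega_V$ is $$\mu^W(du\,ds)=\det A^W_{VV}(u)\prod_{(i\sim j)\in\tilde E}e^{-W_{ij}[\cosh(u_i-u_j)-1+\frac12(s_i-s_j)^2e^{u_i+u_j}]}\prod_{i\in V}\frac{e^{-u_i}}{2\pi}du_i\,ds_i .$$ For $i\in V$: $\beta_i^{V}(u)=\frac12\sum_{j\in\tilde V}W_{ij}e^{u_j-u_i}$, $\theta^{V}_i(u,s)=\sum_{j\in\tilde V}W_{ij}e^{u_j}(s_i-s_j)$. $\mathcal{G}_V$ is the set of $[a,b]=([a_i,b_i])_{i\in\tilde V}$ with $a_i>0$, $b_i\in\mathbb{R}$ and $[a_\delta,b_\delta]=[1,0]$ (so $[a,b]$ is determined by its restriction to $V$). Infinite graph and wired approximation. $G_\infty=(V_\infty,E_\infty)$ is an infinite undirected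 graph with edge weights $W_{ij}=W_{ji}>0$ for $i\sim j$ and $W_{ij}=0$ otherwise. It is approximated by finite graphs $\tilde G_n=(\tilde V_n,\tilde E_n)$, $\tilde V_n=V_n\cup\{\delta_n\}$, with $V_n\subseteq V_{n+1}$ finite subsets of $V_\infty$, $\bigcup_nV_n=V_\infty$, and $\tilde E_n=E_n\cup\{(i\sim\delta_n):i\in V_n,\ \exists j\in V_\infty\setminus V_n:(i\sim j)\in E_\infty\}$, where $E_n$ is the set of edges in $E_\infty$ with both endpoints in $V_n$. Weights on $\tilde G_n$: $W^{(n)}_{ij}=W_{ij}$ for $i,j\in V_n$; $W^{(n)}_{i\delta_n}=W^{(n)}_{\delta_ni}=\sum_{j\in V_\infty\setminus V_n}W_{ij}$ for $i\in V_n$; $W^{(n)}_{\delta_n\delta_n}=0$. It is assumed that these sums are finite and that each $\tilde G_n$ satisfies the assumptions on finite graphs above (finite, connected, no loops, no parallel edges). $\mu_n^W$ denotes the measure above for the graph $\tilde G_n$ with distinguished vertex $\delta_n$ and weights $W^{(n)}$, and $\beta^{V_n},\theta^{V_n}$ are the corresponding variables. *)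

theory Defs
  imports "HOL-Probability.Probability"
begin

section \<open>Finite-volume model\<close>

text \<open>A graph is given by its vertex set and its set of edges, an edge being the set of its
  endpoints. Parallel edges are thus excluded by the encoding.\<close>

definition finite_connected_graph :: "'a set \<Rightarrow> 'a set set \<Rightarrow> bool" where
  "finite_connected_graph VV E \<longleftrightarrow>
     finite VV \<and> (\<forall>e\<in>E. e \<subseteq> VV \<and> card e = 2) \<and>
     (\<forall>i\<in>VV. \<forall>j\<in>VV. (i, j) \<in> {(k, l). {k, l} \<in> E}\<^sup>*)"

definition edge_weights :: "'a set \<Rightarrow> 'a set set \<Rightarrow> ('a \<Rightarrow> 'a \<Rightarrow> real) \<Rightarrow> bool" where
  "edge_weights VV E W \<longleftrightarrow>
     (\<forall>i\<in>VV. \<forall>j\<in>VV. W i j = W j i \<and> (if {i, j} \<in> E then W i j > 0 else W i j = 0))"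

text \<open>In the following, \<open>VV\<close> is the full vertex set, including the distinguished vertex \<open>\<delta>\<close>.
  Configurations are functions extensional on \<open>VV\<close>.\<close>

definition Omega :: "'a set \<Rightarrow> 'a \<Rightarrow> (('a \<Rightarrow> real) \<times> ('a \<Rightarrow> real)) set" where
  "Omega VV \<delta> = {(u, s). u \<in> extensional VV \<and> s \<in> extensional VV \<and> u \<delta> = 0 \<and> s \<delta> = 0}"

definition Omega_borel :: "'a set \<Rightarrow> 'a \<Rightarrow> (('a \<Rightarrow> real) \<times> ('a \<Rightarrow> real)) measure" where
  "Omega_borel VV \<delta> =
     restrict_space ((\<Pi>\<^sub>M i\<in>VV. borel) \<Otimes>\<^sub>M (\<Pi>\<^sub>M i\<in>VV. borel)) (Omega VV \<delta>)"

text \<open>The reference measure: Lebesgue measure in the coordinates \<open>u\<^sub>i, s\<^sub>i\<close>, \<open>i \<noteq> \<delta>\<close>.\<close>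

definition Omega_lebesgue :: "'a set \<Rightarrow> 'a \<Rightarrow> (('a \<Rightarrow> real) \<times> ('a \<Rightarrow> real)) measure" where
  "Omega_lebesgue VV \<delta> =
     distr ((\<Pi>\<^sub>M i\<in>VV - {\<delta>}. lborel) \<Otimes>\<^sub>M (\<Pi>\<^sub>M i\<in>VV - {\<delta>}. lborel))
       (Omega_borel VV \<delta>) (\<lambda>(u, s). (u(\<delta> := 0), s(\<delta> := 0)))"

lemma measurable_extend_zero:
  assumes "\<delta> \<in> VV"
  shows "(\<lambda>(u, s). (u(\<delta> := 0), s(\<delta> := 0))) \<in>
    (\<Pi>\<^sub>M i\<in>VV - {\<delta>}. lborel) \<Otimes>\<^sub>M (\<Pi>\<^sub>M i\<in>VV - {\<delta>}. lborel) \<rightarrow>\<^sub>M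
    Omega_borel VV \<delta>"
proof -
  have V: "VV = insert \<delta> (VV - {\<delta>})" using assms by auto
  have ext: "(\<lambda>u. u(\<delta> := (0::real))) \<in> (\<Pi>\<^sub>M i\<in>VV - {\<delta>}. lborel) \<rightarrow>\<^sub>M (\<Pi>\<^sub>M i\<in>VV. borel)"
    by (subst (2) V, rule measurable_fun_upd[where J = "VV - {\<delta>}"])
       (auto intro: measurable_PiM_single' measurable_component_singleton simp: space_PiM)
  show ?thesis
    unfolding Omega_borel_def
  proof (rule measurable_restrict_space2)
    show "(\<lambda>(u, s). (u(\<delta> := 0), s(\<delta> := 0))) \<in>
      space ((\<Pi>\<^sub>M i\<in>VV - {\<delta>}. lborel) \<Otimes>\<^sub>M (\<Pi>\<^sub>M i\<in>VV - {\<delta>}. lborel)) \<rightarrow> Omega VV \<delta>"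
      using assms
      by (auto simp: Omega_def space_pair_measure space_PiM PiE_def extensional_def)
    show "(\<lambda>(u, s). (u(\<delta> := 0 :: real), s(\<delta> := 0 :: real))) \<in>
      (\<Pi>\<^sub>M i\<in>VV - {\<delta>}. lborel) \<Otimes>\<^sub>M (\<Pi>\<^sub>M i\<in>VV - {\<delta>}. lborel) \<rightarrow>\<^sub>M
      (\<Pi>\<^sub>M i\<in>VV. borel) \<Otimes>\<^sub>M (\<Pi>\<^sub>M i\<in>VV. borel)"
      unfolding split_beta
      by (intro measurable_Pair measurable_compose[OF measurable_fst ext]
        measurable_compose[OF measurable_snd ext])
  qed
qed

definition A_mat :: "'a set \<Rightarrow> ('a \<Rightarrow> 'a \<Rightarrow> real) \<Rightarrow> ('a \<Rightarrow> real) \<Rightarrow> 'a \<Rightarrow> 'a \<Rightarrow> real" where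
  "A_mat VV W u i j =
     (if i = j then \<Sum>k\<in>VV. W i k * exp (u i + u k) else - W i j * exp (u i + u j))"

text \<open>Leibniz formula, as for \<^const>\<open>det\<close>, for matrices indexed by a finite set.\<close>

definition det_on :: "'a set \<Rightarrow> ('a \<Rightarrow> 'a \<Rightarrow> real) \<Rightarrow> real" where
  "det_on I A = (\<Sum>p | p permutes I. of_int (sign p) * (\<Prod>i\<in>I. A i (p i)))"

text \<open>Value of a symmetric function of two vertices at the edge joining them.\<close>

definition on_edge :: "('a \<Rightarrow> 'a \<Rightarrow> real) \<Rightarrow> 'a set \<Rightarrow> real" where
  "on_edge f e = (THE x. \<exists>i j. e = {i, j} \<and> x = f i j)"

lemma on_edge_eq:
  assumes "f i j = f j i"
  shows "on_edge f {i, j} = f i j"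
  unfolding on_edge_def using assms by (intro the_equality) (auto simp: doubleton_eq_iff)

definition mu_density ::
  "'a set \<Rightarrow> 'a \<Rightarrow> 'a set set \<Rightarrow> ('a \<Rightarrow> 'a \<Rightarrow> real) \<Rightarrow> ('a \<Rightarrow> real) \<Rightarrow> ('a \<Rightarrow> real) \<Rightarrow> real" where
  "mu_density VV \<delta> E W u s =
     det_on (VV - {\<delta>}) (A_mat VV W u) *
     (\<Prod>e\<in>E. on_edge (\<lambda>i j. exp (- W i j *
        (cosh (u i - u j) - 1 + 1/2 * (s i - s j)\<^sup>2 * exp (u i + u j)))) e) *
     (\<Prod>i\<in>VV - {\<delta>}. exp (- u i) / (2 * pi))"

text \<open>The determinant is nonnegative, \<open>A\<^bsub>VV\<^esub>\<close> being symmetric and diagonally dominant, so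
  \<^const>\<open>ennreal\<close> does not truncate.\<close>

definition mu_measure ::
  "'a set \<Rightarrow> 'a \<Rightarrow> 'a set set \<Rightarrow> ('a \<Rightarrow> 'a \<Rightarrow> real) \<Rightarrow> (('a \<Rightarrow> real) \<times> ('a \<Rightarrow> real)) measure" where
  "mu_measure VV \<delta> E W =
     density (Omega_lebesgue VV \<delta>) (\<lambda>(u, s). ennreal (mu_density VV \<delta> E W u s))"

definition beta :: "'a set \<Rightarrow> ('a \<Rightarrow> 'a \<Rightarrow> real) \<Rightarrow> ('a \<Rightarrow> real) \<Rightarrow> 'a \<Rightarrow> real" where
  "beta VV W u i = 1/2 * (\<Sum>j\<in>VV. W i j * exp (u j - u i))"

definition theta ::
  "'a set \<Rightarrow> ('a \<Rightarrow> 'a \<Rightarrow> real) \<Rightarrow> ('a \<Rightarrow> real) \<Rightarrow> ('a \<Rightarrow> real) \<Rightarrow> 'a \<Rightarrow> real" where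
  "theta VV W u s i = (\<Sum>j\<in>VV. W i j * exp (u j) * (s i - s j))"

definition G_set :: "'a set \<Rightarrow> 'a \<Rightarrow> (('a \<Rightarrow> real) \<times> ('a \<Rightarrow> real)) set" where
  "G_set VV \<delta> = {(a, b). (\<forall>i\<in>VV. a i > 0) \<and> a \<delta> = 1 \<and> b \<delta> = 0}"

text \<open>The integrand of the joint Laplace transform; it depends on \<open>a\<close> and \<open>b\<close> only through
  their restrictions to \<open>VV - {\<delta>}\<close>.\<close>

definition laplace_integrand ::
  "'a set \<Rightarrow> 'a \<Rightarrow> ('a \<Rightarrow> 'a \<Rightarrow> real) \<Rightarrow> ('a \<Rightarrow> real) \<Rightarrow> ('a \<Rightarrow> real) \<Rightarrow>
   ('a \<Rightarrow> real) \<times> ('a \<Rightarrow> real) \<Rightarrow> real" where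
  "laplace_integrand VV \<delta> W a b = (\<lambda>(u, s).
     exp (- (\<Sum>i\<in>VV - {\<delta>}. ((a i)\<^sup>2 + (b i)\<^sup>2 - 1) * beta VV W u i)
          - (\<Sum>i\<in>VV - {\<delta>}. b i * theta VV W u s i)))"

section \<open>Wired approximation of an infinite graph\<close>

text \<open>The vertices of the wired graphs have type \<open>'v option\<close>, where \<^const>\<open>None\<close> is the wiring
  vertex \<open>\<delta>\<^sub>n\<close> for every \<open>n\<close>.\<close>

definition wired_vertices :: "'v set \<Rightarrow> 'v option set" where
  "wired_vertices U = insert None (Some ` U)"

definition wired_edges :: "'v set \<Rightarrow> 'v set set \<Rightarrow> 'v set \<Rightarrow> 'v option set set" where
  "wired_edges Vinf E U =
     (\<lambda>e. Some ` e) ` {e \<in> E. e \<subseteq> U} \<union>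
     {{Some i, None} | i. i \<in> U \<and> (\<exists>j\<in>Vinf - U. {i, j} \<in> E)}"

definition wired_weights ::
  "'v set \<Rightarrow> ('v \<Rightarrow> 'v \<Rightarrow> real) \<Rightarrow> 'v set \<Rightarrow> 'v option \<Rightarrow> 'v option \<Rightarrow> real" where
  "wired_weights Vinf W U x y =
     (case (x, y) of
        (Some i, Some j) \<Rightarrow> W i j
      | (Some i, None) \<Rightarrow> (\<Sum>\<^sub>\<infinity>j\<in>Vinf - U. W i j)
      | (None, Some i) \<Rightarrow> (\<Sum>\<^sub>\<infinity>j\<in>Vinf - U. W i j)
      | (None, None) \<Rightarrow> 0)"

definition wired_mu ::
  "'v set \<Rightarrow> 'v set set \<Rightarrow> ('v \<Rightarrow> 'v \<Rightarrow> real) \<Rightarrow> 'v set \<Rightarrow>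
   (('v option \<Rightarrow> real) \<times> ('v option \<Rightarrow> real)) measure" where
  "wired_mu Vinf E W U =
     mu_measure (wired_vertices U) None (wired_edges Vinf E U) (wired_weights Vinf W U)"

definition wired_beta ::
  "'v set \<Rightarrow> ('v \<Rightarrow> 'v \<Rightarrow> real) \<Rightarrow> 'v set \<Rightarrow> ('v option \<Rightarrow> real) \<Rightarrow> 'v \<Rightarrow> real" where
  "wired_beta Vinf W U u i = beta (wired_vertices U) (wired_weights Vinf W U) u (Some i)"

definition wired_theta ::
  "'v set \<Rightarrow> ('v \<Rightarrow> 'v \<Rightarrow> real) \<Rightarrow> 'v set \<Rightarrow> ('v option \<Rightarrow> real) \<Rightarrow> ('v option \<Rightarrow> real) \<Rightarrow> 'v \<Rightarrow> real"
where
  "wired_theta Vinf W U u s i = theta (wired_vertices U) (wired_weights Vinf W U) u s (Some i)"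

definition wired_integrand ::
  "'v set \<Rightarrow> ('v \<Rightarrow> 'v \<Rightarrow> real) \<Rightarrow> 'v set \<Rightarrow> ('v option \<Rightarrow> real) \<Rightarrow> ('v option \<Rightarrow> real) \<Rightarrow>
   ('v option \<Rightarrow> real) \<times> ('v option \<Rightarrow> real) \<Rightarrow> real" where
  "wired_integrand Vinf W U =
     laplace_integrand (wired_vertices U) None (wired_weights Vinf W U)"

definition wired_laplace ::
  "'v set \<Rightarrow> 'v set set \<Rightarrow> ('v \<Rightarrow> 'v \<Rightarrow> real) \<Rightarrow> 'v set \<Rightarrow>
   ('v option \<Rightarrow> real) \<Rightarrow> ('v option \<Rightarrow> real) \<Rightarrow> real" where
  "wired_laplace Vinf E W U a b =
     (\<integral>\<omega>. wired_integrand Vinf W U a b \<omega> \<partial>wired_mu Vinf E W U)"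

text \<open>Law under \<open>\<mu>\<^sub>U\<close> of \<open>(\<beta>\<^sub>i, \<theta>\<^sub>i)\<close>, \<open>i \<in> I\<close>, where \<open>I \<subseteq> U\<close>.\<close>

definition wired_law ::
  "'v set \<Rightarrow> 'v set set \<Rightarrow> ('v \<Rightarrow> 'v \<Rightarrow> real) \<Rightarrow> 'v set \<Rightarrow> 'v set \<Rightarrow>
   (('v \<Rightarrow> real) \<times> ('v \<Rightarrow> real)) measure" where
  "wired_law Vinf E W U I =
     distr (wired_mu Vinf E W U) ((\<Pi>\<^sub>M i\<in>I. borel) \<Otimes>\<^sub>M (\<Pi>\<^sub>M i\<in>I. borel))
       (\<lambda>(u, s). (\<lambda>i\<in>I. wired_beta Vinf W U u i, \<lambda>i\<in>I. wired_theta Vinf W U u s i))"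

end

theory Submission
  imports Defs
begin

text \<open>Write \<open>p\<^sub>i = exp (u i)\<close>. The proof integrates out one vertex \<open>k\<close> at a time, in coordinates
  adapted to the statement: instead of \<open>u\<^sub>k\<close> and \<open>s\<^sub>k\<close> one uses \<open>y = 2 \<beta>\<^sub>k\<close> and \<open>t = \<theta>\<^sub>k\<close>. With
  \<open>S = \<Sum>\<^sub>j W\<^sub>k\<^sub>j p\<^sub>j\<close> and \<open>R = \<Sum>\<^sub>j W\<^sub>k\<^sub>j p\<^sub>j s\<^sub>j\<close> one has \<open>y = S / p\<^sub>k\<close> and \<open>t = S s\<^sub>k - R\<close>, so for
  \<open>x = ln y\<close> both changes of variables are affine on the real line. The remaining vertices then
  see the same model with weights \<open>W\<^sub>i\<^sub>j + W\<^sub>i\<^sub>k W\<^sub>k\<^sub>j / y\<close>, as for the star-mesh reduction of electrical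
  networks: \<open>\<beta>\<^sub>i\<close> and \<open>\<theta>\<^sub>i\<close> change by \<open>W\<^sub>i\<^sub>k\<^sup>2 / (2 y)\<close> and \<open>- W\<^sub>i\<^sub>k t / y\<close>, the determinant factorises by
  a Schur complement, and the density splits off the factor
  \<open>exp (D - y / 2 - (D\<^sup>2 + t\<^sup>2) / (2 y)) / (2 \<pi>)\<close>, where \<open>D = \<Sum>\<^sub>j W\<^sub>k\<^sub>j\<close>. This is
  \<open>field_integral_eliminate\<close>.

  Two inductions over vertices follow from it. The first one, \<open>field_integral_laplace_kernel\<close>,
  computes the joint Laplace transform of \<open>\<beta>\<close> and \<open>\<theta>\<close> explicitly. Its induction step is a Gaussian integral
  in \<open>t\<close> followed by an inverse Gaussian integral in \<open>y\<close>. In particular it gives that the total mass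
  is one and that the Laplace transforms at issue are finite.

  The second one, \<open>field_integral_wire\<close>, compares the model on \<open>V\<close> with the model in which all vertices
  outside \<open>V\<^sub>0 \<subseteq> V\<close> are merged with \<open>\<delta>\<close>. Eliminating a vertex of \<open>V\<^sub>0\<close> commutes with this wiring,
  and the factor split off from the density involves only \<open>D\<close>, which the wiring preserves. Hence
  all vertices of \<open>V\<^sub>0\<close> can be eliminated simultaneously in both models. What is left on both sides
  is a total mass, that is, one. The law of \<open>\<beta>\<close> and \<open>\<theta>\<close> on \<open>V\<^sub>0\<close> is thus the same in both models,
  for indicator functions as well as for exponentials, so that the identity of Laplace transforms and that
  of laws both come out, neither being deduced from the other. Finally the graph wired at \<open>V n\<close>
  arises from the one wired at \<open>V (Suc n)\<close> in this way.\<close>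

section \<open>Schur complements of determinants over finite index sets\<close>

lemma det_on_row_add:
  fixes A :: "'a \<Rightarrow> 'a \<Rightarrow> real"
  assumes I: "finite I" "r \<in> I"
  shows "det_on I (A(r := (\<lambda>j. x j + c * y j))) = det_on I (A(r := x)) + c * det_on I (A(r := y))"
proof -
  have "(\<Prod>i\<in>I. (A(r := (\<lambda>j. x j + c * y j))) i (p i)) =
    (\<Prod>i\<in>I. (A(r := x)) i (p i)) + c * (\<Prod>i\<in>I. (A(r := y)) i (p i))" for p
  proof -
    have *: "(\<Prod>i\<in>I. (A(r := z)) i (p i)) = z (p r) * (\<Prod>i\<in>I - {r}. A i (p i))" for z
      using I by (subst prod.remove[of _ r]) (auto intro!: prod.cong)
    show ?thesis unfolding * by (simp add: algebra_simps)
  qed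
  then show ?thesis
    unfolding det_on_def by (simp add: sum.distrib sum_distrib_left algebra_simps)
qed

text \<open>Composing with the transposition of the two rows is a sign-reversing bijection on the terms of
  the Leibniz formula.\<close>

lemma det_on_equal_rows:
  fixes A :: "'a \<Rightarrow> 'a \<Rightarrow> real"
  assumes I: "finite I" "r \<in> I" "k \<in> I" "r \<noteq> k" and eq: "A r = A k"
  shows "det_on I A = 0"
proof -
  let ?t = "Transposition.transpose r k"
  have t: "?t permutes I" using I by (simp add: permutes_swap_id)
  have "det_on I A = (\<Sum>p | p permutes I. of_int (sign (p \<circ> ?t)) * (\<Prod>i\<in>I. A i ((p \<circ> ?t) i)))"
    unfolding det_on_def by (rule sum_permutations_compose_right[OF t])
  also have "\<dots> = (\<Sum>p | p permutes I. - (of_int (sign p) * (\<Prod>i\<in>I. A i (p i))))"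
  proof (intro sum.cong refl)
    fix p assume "p \<in> {p. p permutes I}"
    then have p: "p permutes I" by simp
    have "sign (p \<circ> ?t) = - sign p"
      using p t I by (simp add: sign_compose permutation_permutes[THEN iffD2] sign_swap_id
          permutes_imp_permutation)
    moreover have "(\<Prod>i\<in>I. A i ((p \<circ> ?t) i)) = (\<Prod>i\<in>I. A (?t i) (p (?t i)))"
      using eq by (intro prod.cong) (auto simp: Transposition.transpose_def)
    moreover have "\<dots> = (\<Prod>i\<in>I. A i (p i))"
      using prod.permute[OF t, of "\<lambda>i. A i (p i)"] by (simp add: o_def)
    ultimately show "of_int (sign (p \<circ> ?t)) * (\<Prod>i\<in>I. A i ((p \<circ> ?t) i)) =
      - (of_int (sign p) * (\<Prod>i\<in>I. A i (p i)))" by simp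
  qed
  also have "\<dots> = - det_on I A" unfolding det_on_def by (simp add: sum_negf)
  finally show ?thesis by simp
qed

lemma det_on_add_multiples_of_row:
  fixes A :: "'a \<Rightarrow> 'a \<Rightarrow> real"
  assumes I: "finite I" "k \<in> I" and J: "J \<subseteq> I - {k}"
  shows "det_on I (\<lambda>i j. if i \<in> J then A i j + c i * A k j else A i j) = det_on I A"
proof -
  have "finite J" using I J finite_subset by blast
  then show ?thesis using J
  proof (induction J)
    case (insert r J)
    have "r \<in> I" "r \<noteq> k" "k \<notin> J" using insert.prems by auto
    let ?B = "\<lambda>i j. if i \<in> J then A i j + c i * A k j else A i j"
    have "(\<lambda>i j. if i \<in> insert r J then A i j + c i * A k j else A i j) =
      ?B(r := (\<lambda>j. A r j + c r * A k j))" by (auto simp: fun_eq_iff)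
    then have "det_on I (\<lambda>i j. if i \<in> insert r J then A i j + c i * A k j else A i j) =
      det_on I (?B(r := A r)) + c r * det_on I (?B(r := A k))"
      using det_on_row_add[of I r ?B "A r" "c r" "A k"] I(1) \<open>r \<in> I\<close> by simp
    also have "?B(r := A r) = ?B" using insert.hyps by auto
    also have "det_on I (?B(r := A k)) = 0"
      by (intro det_on_equal_rows[of I r k]) (use I \<open>r \<in> I\<close> \<open>r \<noteq> k\<close> \<open>k \<notin> J\<close> in auto)
    finally show ?case using insert by simp
  qed simp
qed

lemma det_on_cong:
  assumes "\<And>i j. i \<in> I \<Longrightarrow> j \<in> I \<Longrightarrow> A i j = B i j"
  shows "det_on I A = det_on I B"
  unfolding det_on_def
  by (intro sum.cong arg_cong2[where f = "(*)"] refl prod.cong) (auto simp: assms permutes_in_image)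

text \<open>Subtracting multiples of row \<open>k\<close> from the other rows clears column \<open>k\<close> outside the diagonal, so that
  only the permutations fixing \<open>k\<close> contribute.\<close>

lemma det_on_insert_Schur:
  fixes A :: "'a \<Rightarrow> 'a \<Rightarrow> real"
  assumes I: "finite I" "k \<notin> I" and nz: "A k k \<noteq> 0"
  shows "det_on (insert k I) A = A k k * det_on I (\<lambda>i j. A i j - A i k * A k j / A k k)"
proof -
  let ?B = "\<lambda>i j. if i \<in> I then A i j + (- A i k / A k k) * A k j else A i j"
  let ?C = "\<lambda>i j. A i j - A i k * A k j / A k k"
  have "det_on (insert k I) A = det_on (insert k I) ?B"
    using det_on_add_multiples_of_row[of "insert k I" k I A "\<lambda>i. - A i k / A k k"] I by auto
  also have "\<dots> = (\<Sum>p | p permutes I. of_int (sign p) * (\<Prod>i\<in>insert k I. ?B i (p i)))"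
    unfolding det_on_def
  proof (rule sum.mono_neutral_right)
    show "finite {p. p permutes insert k I}" using I by (simp add: finite_permutations)
    show "{p. p permutes I} \<subseteq> {p. p permutes insert k I}"
      using permutes_subset by blast
    show "\<forall>p\<in>{p. p permutes insert k I} - {p. p permutes I}.
      of_int (sign p) * (\<Prod>i\<in>insert k I. ?B i (p i)) = 0"
    proof
      fix p assume p: "p \<in> {p. p permutes insert k I} - {p. p permutes I}"
      then have perm: "p permutes insert k I" by simp
      have "p k \<noteq> k"
        using p permutes_superset[OF perm, of I] by auto
      obtain i where i: "i \<in> insert k I" "p i = k"
        using permutes_image[OF perm] by (metis (mono_tags, opaque_lifting) imageE insertI1)
      with \<open>p k \<noteq> k\<close> have "i \<in> I" by auto
      then have "?B i (p i) = 0" using i nz by simp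
      then have "(\<Prod>i\<in>insert k I. ?B i (p i)) = 0"
        using I i(1) by (intro prod_zero) blast+
      then show "of_int (sign p) * (\<Prod>i\<in>insert k I. ?B i (p i)) = 0" by simp
    qed
  qed
  also have "\<dots> = (\<Sum>p | p permutes I. A k k * (of_int (sign p) * (\<Prod>i\<in>I. ?C i (p i))))"
  proof (intro sum.cong refl)
    fix p assume "p \<in> {p. p permutes I}"
    then have "p k = k" using I by (auto simp: permutes_def)
    then have "(\<Prod>i\<in>insert k I. ?B i (p i)) = A k k * (\<Prod>i\<in>I. ?C i (p i))"
      using I by (subst prod.insert) (auto intro!: prod.cong)
    then show "of_int (sign p) * (\<Prod>i\<in>insert k I. ?B i (p i)) =
      A k k * (of_int (sign p) * (\<Prod>i\<in>I. ?C i (p i)))" by simp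
  qed
  also have "\<dots> = A k k * det_on I ?C"
    unfolding det_on_def by (simp add: sum_distrib_left)
  finally show ?thesis .
qed

section \<open>Gaussian and inverse Gaussian integrals\<close>

lemma borel_measurable_cosh [measurable]: "(\<lambda>x::real. cosh x) \<in> borel_measurable borel"
  by (intro borel_measurable_continuous_onI continuous_intros)

lemma nn_integral_gaussian:
  fixes m v :: real
  assumes v: "v > 0"
  shows "(\<integral>\<^sup>+t. ennreal (exp (- (t - m)\<^sup>2 / (2 * v))) \<partial>lborel) = ennreal (sqrt (2 * pi * v))"
proof -
  have "(\<integral>\<^sup>+t. ennreal (normal_density m (sqrt v) t) \<partial>lborel) = 1"
    using v by (subst nn_integral_eq_integral) auto
  moreover have "exp (- (t - m)\<^sup>2 / (2 * v)) = sqrt (2 * pi * v) * normal_density m (sqrt v) t" for t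
    using v unfolding normal_density_def by simp
  ultimately show ?thesis
    using v by (simp add: ennreal_mult' nn_integral_cmult)
qed

text \<open>The substitution \<open>z = 2 sinh (x / 2)\<close> turns the integrand into a Gaussian, since
  \<open>cosh x = 1 + z\<^sup>2 / 2\<close> and \<open>dz = cosh (x / 2) dx\<close>. It is used in the direction from \<open>x\<close> to \<open>z\<close>, with
  \<open>x = 2 arsinh (z / 2)\<close>, because then integrability has to be known for the Gaussian only.\<close>

lemma nn_integral_cosh_half_exp_cosh:
  fixes c :: real
  assumes c: "c > 0"
  shows "(\<integral>\<^sup>+x. ennreal (cosh (x / 2) * exp (- c * cosh x)) \<partial>lborel) =
    ennreal (exp (- c) * sqrt (2 * pi / c))"
proof -
  let ?f = "\<lambda>x::real. cosh (x / 2) * exp (- c * cosh x)"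
  let ?g = "\<lambda>z::real. 2 * arsinh (z / 2)"
  let ?g' = "\<lambda>z::real. 1 / sqrt ((z / 2)\<^sup>2 + 1)"
  let ?h = "\<lambda>z::real. exp (- c) * exp (- (z - 0)\<^sup>2 / (2 * (1 / c)))"
  have fg: "?f (?g z) * ?g' z = ?h z" for z
  proof -
    have "cosh (?g z) = 1 + 2 * (z / 2)\<^sup>2"
      unfolding cosh_double by (simp add: cosh_arsinh_real)
    then have "exp (- c * cosh (?g z)) = ?h z"
      using c by (simp add: exp_add[symmetric] field_simps power2_eq_square)
    moreover have "sqrt ((z / 2)\<^sup>2 + 1) \<noteq> 0"
      by (smt (verit, best) real_sqrt_eq_zero_cancel_iff zero_le_power2)
    ultimately show ?thesis by (simp add: cosh_arsinh_real del: real_sqrt_eq_zero_cancel_iff)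
  qed
  have h_nn: "(\<integral>\<^sup>+z. ennreal (?h z) \<partial>lborel) = ennreal (exp (- c) * sqrt (2 * pi / c))"
    using nn_integral_gaussian[of "1 / c" 0] c by (simp add: ennreal_mult' nn_integral_cmult)
  have h_int: "integrable lborel ?h"
    by (rule integrableI_nonneg) (use h_nn in \<open>auto simp: less_top\<close>)
  have lim_top: "filterlim ?g at_top at_top"
    by (intro filterlim_tendsto_pos_mult_at_top[OF tendsto_const]
        filterlim_compose[OF arsinh_real_at_top] filterlim_at_top_mult_at_top | simp)+
      (intro filterlim_tendsto_pos_mult_at_top[of "\<lambda>_. 1/2" "1/2" _ "\<lambda>x. x", simplified] filterlim_ident)
  have lim_bot: "filterlim ?g at_bot at_bot"
  proof -
    have "filterlim (\<lambda>x. - ?g (- x)) at_bot at_bot"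
      unfolding filterlim_uminus_at_bot
      using filterlim_compose[OF lim_top filterlim_uminus_at_top_at_bot] by simp
    then show ?thesis by simp
  qed
  have sub: "set_integrable lborel (einterval (-\<infinity>) \<infinity>) ?f"
    "(LBINT x=-\<infinity>..\<infinity>. ?f x) = (LBINT z=-\<infinity>..\<infinity>. ?f (?g z) * ?g' z)"
  proof -
    have *: "\<And>x. DERIV ?g x :> ?g' x"
      by (rule DERIV_cong[OF DERIV_cmult[OF DERIV_chain2[OF arsinh_real_has_field_derivative
              DERIV_cdivide[OF DERIV_ident]]]]) simp
    have A: "((ereal \<circ> ?g \<circ> real_of_ereal) \<longlongrightarrow> -\<infinity>) (at_right (-\<infinity>))"
      using lim_bot by (simp add: ereal_tendsto_simps)
    have B: "((ereal \<circ> ?g \<circ> real_of_ereal) \<longlongrightarrow> \<infinity>) (at_left \<infinity>)"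
      using lim_top by (simp add: ereal_tendsto_simps)
    have I: "set_integrable lborel (einterval (-\<infinity>) \<infinity>) (\<lambda>z. ?f (?g z) * ?g' z)"
      unfolding fg using h_int by (simp add: set_integrable_def)
    have pos: "sqrt ((x / 2)\<^sup>2 + 1) \<noteq> 0" for x :: real
      by (smt (verit, best) real_sqrt_eq_zero_cancel_iff zero_le_power2)
    show "set_integrable lborel (einterval (-\<infinity>) \<infinity>) ?f"
      by (rule interval_integral_substitution_nonneg(1)[OF _ * _ _ _ _ A B I])
        (auto intro!: continuous_intros pos)
    show "(LBINT x=-\<infinity>..\<infinity>. ?f x) = (LBINT z=-\<infinity>..\<infinity>. ?f (?g z) * ?g' z)"
      by (rule interval_integral_substitution_nonneg(2)[OF _ * _ _ _ _ A B I])
        (auto intro!: continuous_intros pos)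
  qed
  have "integrable lborel ?f" using sub(1) by (simp add: set_integrable_def)
  then have "(\<integral>\<^sup>+x. ennreal (?f x) \<partial>lborel) = ennreal (\<integral>x. ?f x \<partial>lborel)"
    by (intro nn_integral_eq_integral) auto
  also have "(\<integral>x. ?f x \<partial>lborel) = (\<integral>z. ?h z \<partial>lborel)"
    using sub(2) unfolding fg by (simp add: interval_lebesgue_integral_def set_lebesgue_integral_def)
  also have "ennreal (\<integral>z. ?h z \<partial>lborel) = (\<integral>\<^sup>+z. ennreal (?h z) \<partial>lborel)"
    using h_int by (intro nn_integral_eq_integral[symmetric]) auto
  finally show ?thesis using h_nn by simp
qed

text \<open>Symmetrising under \<open>x \<mapsto> - x\<close> replaces \<open>exp (x / 2)\<close> by \<open>cosh (x / 2)\<close>.\<close>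

lemma nn_integral_exp_half_exp_cosh:
  fixes c :: real
  assumes c: "c > 0"
  shows "(\<integral>\<^sup>+x. ennreal (exp (x / 2 - c * cosh x)) \<partial>lborel) = ennreal (exp (- c) * sqrt (2 * pi / c))"
    (is "?I = ?r")
proof -
  have refl: "(\<integral>\<^sup>+x. ennreal (exp (- x / 2 - c * cosh x)) \<partial>lborel) = ?I"
    using nn_integral_real_affine[of "\<lambda>x. ennreal (exp (x / 2 - c * cosh x))" "-1" 0]
    by simp
  have "?I + ?I = (\<integral>\<^sup>+x. ennreal (exp (x / 2 - c * cosh x)) + ennreal (exp (- x / 2 - c * cosh x)) \<partial>lborel)"
    by (subst nn_integral_add) (simp_all only: refl, simp_all)
  also have "\<dots> = (\<integral>\<^sup>+x. 2 * ennreal (cosh (x / 2) * exp (- c * cosh x)) \<partial>lborel)"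
  proof (intro nn_integral_cong)
    fix x :: real
    have "exp (x / 2 - c * cosh x) + exp (- x / 2 - c * cosh x) = 2 * (cosh (x / 2) * exp (- c * cosh x))"
    proof -
      have e: "exp (x / 2 - c * cosh x) = exp (x / 2) * exp (- c * cosh x)"
        "exp (- x / 2 - c * cosh x) = exp (- (x / 2)) * exp (- c * cosh x)"
        using exp_add[of "x / 2" "- c * cosh x"] exp_add[of "- (x / 2)" "- c * cosh x"] by simp_all
      have d: "E * K + F * K = 2 * ((E + F) / 2 * K)" for E F K :: real
        by (simp add: distrib_right)
      show ?thesis unfolding e cosh_field_def[of "x / 2"] by (rule d)
    qed
    then have "ennreal (exp (x / 2 - c * cosh x)) + ennreal (exp (- x / 2 - c * cosh x)) =
      ennreal (2 * (cosh (x / 2) * exp (- c * cosh x)))"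
      by (simp add: ennreal_plus[symmetric] del: ennreal_plus)
    then show "ennreal (exp (x / 2 - c * cosh x)) + ennreal (exp (- x / 2 - c * cosh x)) =
      2 * ennreal (cosh (x / 2) * exp (- c * cosh x))"
      by (simp add: ennreal_mult')
  qed
  also have "\<dots> = 2 * ?r"
    by (subst nn_integral_cmult) (simp_all only: nn_integral_cosh_half_exp_cosh[OF c], simp_all)
  finally have "?I + ?I = 2 * ?r" .
  moreover have "y = z" if "y + y = 2 * z" for y z :: ennreal
    using that by (simp add: mult_2[symmetric] ennreal_mult_cancel_left)
  ultimately show ?thesis by blast
qed

text \<open>The total mass of an inverse Gaussian law, in the variable \<open>x = ln y\<close>. The shift by \<open>ln (A / \<alpha>)\<close>
  makes the exponent symmetric.\<close>

lemma nn_integral_inverse_gaussian: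
  fixes \<alpha> A :: real
  assumes pos: "\<alpha> > 0" "A > 0"
  shows "(\<integral>\<^sup>+x. ennreal (exp (x / 2 - \<alpha>\<^sup>2 * exp x / 2 - A\<^sup>2 / (2 * exp x))) \<partial>lborel) =
    ennreal (sqrt (2 * pi) * exp (- \<alpha> * A) / \<alpha>)"
proof -
  let ?l = "ln (A / \<alpha>)"
  have *: "exp ((?l + 1 * x) / 2 - \<alpha>\<^sup>2 * exp (?l + 1 * x) / 2 - A\<^sup>2 / (2 * exp (?l + 1 * x))) =
    sqrt (A / \<alpha>) * exp (x / 2 - (\<alpha> * A) * cosh x)" for x
  proof -
    have e: "exp (?l + x) = A / \<alpha> * exp x" using pos by (simp add: exp_add)
    have "exp (?l / 2) = sqrt (A / \<alpha>)"
      using pos by (simp add: powr_half_sqrt[symmetric] powr_def)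
    moreover have "\<alpha>\<^sup>2 * exp (?l + x) / 2 + A\<^sup>2 / (2 * exp (?l + x)) = (\<alpha> * A) * cosh x"
      unfolding e cosh_field_def using pos
      by (simp add: field_simps power2_eq_square exp_minus)
    then have "(?l + 1 * x) / 2 - \<alpha>\<^sup>2 * exp (?l + 1 * x) / 2 - A\<^sup>2 / (2 * exp (?l + 1 * x)) =
      ?l / 2 + (x / 2 - (\<alpha> * A) * cosh x)" unfolding mult_1 add_divide_distrib by linarith
    ultimately show ?thesis by (simp only: exp_add)
  qed
  have "(\<integral>\<^sup>+x. ennreal (exp (x / 2 - \<alpha>\<^sup>2 * exp x / 2 - A\<^sup>2 / (2 * exp x))) \<partial>lborel) =
    (\<integral>\<^sup>+x. ennreal (sqrt (A / \<alpha>) * exp (x / 2 - (\<alpha> * A) * cosh x)) \<partial>lborel)"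
    by (subst nn_integral_real_affine[of _ 1 ?l]) (simp_all only: *, simp_all)
  also have "\<dots> = ennreal (sqrt (A / \<alpha>)) * ennreal (exp (- (\<alpha> * A)) * sqrt (2 * pi / (\<alpha> * A)))"
    using pos by (simp add: ennreal_mult' nn_integral_cmult nn_integral_exp_half_exp_cosh)
  also have "\<dots> = ennreal (sqrt (2 * pi) * exp (- \<alpha> * A) / \<alpha>)"
  proof -
    have "sqrt (A / \<alpha>) * sqrt (2 * pi / (\<alpha> * A)) = sqrt ((A / \<alpha>) * (2 * pi / (\<alpha> * A)))"
      by (rule real_sqrt_mult[symmetric])
    also have "(A / \<alpha>) * (2 * pi / (\<alpha> * A)) = 2 * pi / \<alpha>\<^sup>2"
      using pos by (simp add: field_simps power2_eq_square)
    also have "sqrt \<dots> = sqrt (2 * pi) / \<alpha>" using pos by (simp add: real_sqrt_divide)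
    finally have e: "sqrt (A / \<alpha>) * sqrt (2 * pi / (\<alpha> * A)) = sqrt (2 * pi) / \<alpha>" .
    have "x * (E * z) = y * E / \<alpha>" if "x * z = y / \<alpha>" for x y z E :: real
    proof -
      have "x * (E * z) = (x * z) * E" by (simp only: ac_simps)
      then show ?thesis using that by simp
    qed
    from this[OF e] have "sqrt (A / \<alpha>) * (exp (- (\<alpha> * A)) * sqrt (2 * pi / (\<alpha> * A))) =
      sqrt (2 * pi) * exp (- \<alpha> * A) / \<alpha>" by simp
    then show ?thesis using pos by (subst ennreal_mult'[symmetric]) simp_all
  qed
  finally show ?thesis .
qed

lemma nn_integral_inverse_gaussian_gaussian:
  fixes \<alpha> A b m :: real
  assumes pos: "\<alpha> > 0" "A > 0"
  shows "(\<integral>\<^sup>+x. \<integral>\<^sup>+t. ennreal (exp (- \<alpha>\<^sup>2 * exp x / 2 - A\<^sup>2 / (2 * exp x)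
      - (t + b * exp x - m)\<^sup>2 / (2 * exp x))) \<partial>lborel \<partial>lborel) =
    ennreal (2 * pi * exp (- \<alpha> * A) / \<alpha>)"
proof -
  have "(\<integral>\<^sup>+t. ennreal (exp (- \<alpha>\<^sup>2 * exp x / 2 - A\<^sup>2 / (2 * exp x)
      - (t + b * exp x - m)\<^sup>2 / (2 * exp x))) \<partial>lborel) =
    ennreal (sqrt (2 * pi)) * ennreal (exp (x / 2 - \<alpha>\<^sup>2 * exp x / 2 - A\<^sup>2 / (2 * exp x)))" for x
  proof -
    let ?K = "exp (- \<alpha>\<^sup>2 * exp x / 2 - A\<^sup>2 / (2 * exp x))"
    have "ennreal (exp (- \<alpha>\<^sup>2 * exp x / 2 - A\<^sup>2 / (2 * exp x) - (t + b * exp x - m)\<^sup>2 / (2 * exp x))) =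
      ennreal ?K * ennreal (exp (- (t - (m - b * exp x))\<^sup>2 / (2 * exp x)))" for t
    proof -
      have e: "t - (m - b * exp x) = t + b * exp x - m" by simp
      have "ennreal (exp (c - q / d)) = ennreal (exp c) * ennreal (exp (- q / d))" for c q d :: real
        by (simp add: ennreal_mult'[symmetric] exp_add[symmetric])
      then show ?thesis unfolding e .
    qed
    then have "(\<integral>\<^sup>+t. ennreal (exp (- \<alpha>\<^sup>2 * exp x / 2 - A\<^sup>2 / (2 * exp x)
        - (t + b * exp x - m)\<^sup>2 / (2 * exp x))) \<partial>lborel) = ennreal ?K * ennreal (sqrt (2 * pi * exp x))"
      by (simp only:) (subst nn_integral_cmult, simp_all only: nn_integral_gaussian exp_gt_zero, simp)
    also have "sqrt (2 * pi * exp x) = sqrt (2 * pi) * exp (x / 2)"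
    proof -
      have "sqrt (exp x) = exp (x / 2)"
        by (rule real_sqrt_unique) (simp_all add: exp_double[symmetric])
      then show ?thesis by (simp only: real_sqrt_mult)
    qed
    also have "ennreal ?K * ennreal (sqrt (2 * pi) * exp (x / 2)) = ennreal (sqrt (2 * pi)) *
      ennreal (exp (x / 2 - \<alpha>\<^sup>2 * exp x / 2 - A\<^sup>2 / (2 * exp x)))"
    proof -
      have "?K * (sqrt (2 * pi) * exp (x / 2)) = sqrt (2 * pi) * (?K * exp (x / 2))" by simp
      also have "?K * exp (x / 2) = exp (x / 2 - \<alpha>\<^sup>2 * exp x / 2 - A\<^sup>2 / (2 * exp x))"
        by (simp add: exp_add[symmetric])
      finally show ?thesis by (simp add: ennreal_mult'[symmetric])
    qed
    finally show ?thesis .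
  qed
  then have "(\<integral>\<^sup>+x. \<integral>\<^sup>+t. ennreal (exp (- \<alpha>\<^sup>2 * exp x / 2 - A\<^sup>2 / (2 * exp x)
      - (t + b * exp x - m)\<^sup>2 / (2 * exp x))) \<partial>lborel \<partial>lborel) =
    ennreal (sqrt (2 * pi)) * ennreal (sqrt (2 * pi) * exp (- \<alpha> * A) / \<alpha>)"
    by (simp only:) (subst nn_integral_cmult, simp_all only: nn_integral_inverse_gaussian[OF pos], simp)
  also have "\<dots> = ennreal (2 * pi * exp (- \<alpha> * A) / \<alpha>)"
  proof -
    have "sqrt (2 * pi) * (sqrt (2 * pi) * exp (- \<alpha> * A) / \<alpha>) =
      (sqrt (2 * pi) * sqrt (2 * pi)) * exp (- \<alpha> * A) / \<alpha>" by (simp only: ac_simps times_divide_eq_right)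
    also have "sqrt (2 * pi) * sqrt (2 * pi) = 2 * pi" by simp
    finally have e: "sqrt (2 * pi) * (sqrt (2 * pi) * exp (- \<alpha> * A) / \<alpha>) =
      2 * pi * exp (- \<alpha> * A) / \<alpha>" .
    show ?thesis unfolding e[symmetric] by (rule ennreal_mult'[symmetric]) simp
  qed
  finally show ?thesis .
qed

section \<open>Eliminating a vertex pointwise\<close>

text \<open>The exponent of the density. It is a sum over ordered pairs, so that no edge set is needed:
  the weights vanish off the edges, and eliminating a vertex changes only the weights.\<close>

definition energy :: "'a set \<Rightarrow> ('a \<Rightarrow> 'a \<Rightarrow> real) \<Rightarrow> ('a \<Rightarrow> real) \<Rightarrow> ('a \<Rightarrow> real) \<Rightarrow> real" where
  "energy T W u s = 1/2 * (\<Sum>i\<in>T. \<Sum>j\<in>T. W i j *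
     (cosh (u i - u j) - 1 + 1/2 * (s i - s j)\<^sup>2 * exp (u i + u j)))"

definition field_density ::
  "'a set \<Rightarrow> 'a \<Rightarrow> ('a \<Rightarrow> 'a \<Rightarrow> real) \<Rightarrow> ('a \<Rightarrow> real) \<Rightarrow> ('a \<Rightarrow> real) \<Rightarrow> real" where
  "field_density V \<delta> W u s = det_on V (A_mat (insert \<delta> V) W u) * exp (- energy (insert \<delta> V) W u s) *
     (\<Prod>i\<in>V. exp (- u i) / (2 * pi))"

text \<open>Star-mesh reduction. The product term would create a loop at each neighbour of \<open>k\<close>; it is dropped, at the price of the shift
  of \<open>\<beta>\<close> in \<open>beta_remaining\<close> below.\<close>

definition eliminate :: "('a \<Rightarrow> 'a \<Rightarrow> real) \<Rightarrow> 'a \<Rightarrow> real \<Rightarrow> 'a \<Rightarrow> 'a \<Rightarrow> real" where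
  "eliminate W k y i j = (if i = j then 0 else W i j + W i k * W k j / y)"

text \<open>The density of \<open>x = ln (2 \<beta>\<^sub>k)\<close> and \<open>t = \<theta>\<^sub>k\<close> at a vertex of total weight \<open>D\<close>.\<close>

definition elimination_kernel :: "real \<Rightarrow> real \<Rightarrow> real \<Rightarrow> real" where
  "elimination_kernel D x t = exp (D - exp x / 2 - (D\<^sup>2 + t\<^sup>2) / (2 * exp x)) / (2 * pi)"

text \<open>By symmetry of \<open>W\<close> the summand may be replaced by any other one with the same symmetric part. The one
  chosen here is, in the index \<open>j\<close>, a combination of \<open>1\<close>, \<open>exp (u j)\<close> and \<open>exp (u j) * s j\<close>, which are
  the functions whose weighted sums around \<open>k\<close> are \<open>D\<close>, \<open>S\<close> and \<open>R\<close>.\<close>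

lemma energy_asymmetric:
  assumes sym: "\<And>i j. i \<in> T \<Longrightarrow> j \<in> T \<Longrightarrow> W i j = W j i"
  shows "energy T W u s = 1/2 * (\<Sum>i\<in>T. \<Sum>j\<in>T. W i j *
    (exp (u j) / exp (u i) - 1 + exp (u i) * exp (u j) * (s i)\<^sup>2 - exp (u i) * s i * (exp (u j) * s j)))"
proof -
  let ?g = "\<lambda>i j. exp (u j) / exp (u i) - 1 + exp (u i) * exp (u j) * (s i)\<^sup>2
    - exp (u i) * s i * (exp (u j) * s j)"
  have g: "cosh (u i - u j) - 1 + 1/2 * (s i - s j)\<^sup>2 * exp (u i + u j) = 1/2 * (?g i j + ?g j i)" for i j
  proof -
    have "cosh (u i - u j) = (exp (u i) / exp (u j) + exp (u j) / exp (u i)) / 2"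
      by (simp add: cosh_field_def exp_diff)
    then show ?thesis
      by (simp add: exp_add power2_eq_square algebra_simps)
  qed
  have "(\<Sum>i\<in>T. \<Sum>j\<in>T. W i j * (1/2 * (?g i j + ?g j i))) =
    1/2 * ((\<Sum>i\<in>T. \<Sum>j\<in>T. W i j * ?g i j) + (\<Sum>i\<in>T. \<Sum>j\<in>T. W i j * ?g j i))"
    by (simp only: sum_distrib_left sum.distrib[symmetric] distrib_left mult.left_commute[of "1/2"])
  also have "(\<Sum>i\<in>T. \<Sum>j\<in>T. W i j * ?g j i) = (\<Sum>j\<in>T. \<Sum>i\<in>T. W i j * ?g j i)"
    by (rule sum.swap)
  also have "\<dots> = (\<Sum>i\<in>T. \<Sum>j\<in>T. W i j * ?g i j)"
    by (intro sum.cong refl arg_cong2[where f = "(*)"] sym) auto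
  finally show ?thesis unfolding energy_def g by simp
qed

text \<open>The diagonal correction is the missing loop. It disappears whenever \<open>f i = 0\<close>, as for the
  summands of \<open>\<theta>\<close> and of the energy.\<close>

lemma sum_eliminate:
  assumes fin: "finite T" and i: "i \<in> T" and diag: "W i i = 0" and sym: "W i k = W k i"
  shows "(\<Sum>j\<in>T. eliminate W k y i j * f j) =
    (\<Sum>j\<in>T. W i j * f j) + W i k / y * (\<Sum>j\<in>T. W k j * f j) - (W i k)\<^sup>2 / y * f i"
proof -
  have "(\<Sum>j\<in>T. eliminate W k y i j * f j) =
    (\<Sum>j\<in>T. (W i j * f j + W i k / y * (W k j * f j)) - (if i = j then (W i k)\<^sup>2 / y * f j else 0))"
    using diag sym by (intro sum.cong) (auto simp: eliminate_def power2_eq_square algebra_simps)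
  also have "\<dots> = (\<Sum>j\<in>T. W i j * f j) + W i k / y * (\<Sum>j\<in>T. W k j * f j) - (W i k)\<^sup>2 / y * f i"
    using fin i by (simp add: sum_subtractf sum.distrib sum_distrib_left)
  finally show ?thesis .
qed

text \<open>In the next statements \<open>u\<close> and \<open>s\<close> are the fields on \<open>T\<close>, and \<open>u1\<close> and \<open>s1\<close> extend them to
  \<open>k\<close> by the values for which \<open>2 \<beta>\<^sub>k = exp x\<close> and \<open>\<theta>\<^sub>k = t\<close>.\<close>

context
  fixes T :: "'a set" and k :: 'a and W :: "'a \<Rightarrow> 'a \<Rightarrow> real" and u s u1 s1 :: "'a \<Rightarrow> real" and x t S R :: real
  assumes fin: "finite T" and k: "k \<notin> T"
    and sym: "\<And>i j. i \<in> insert k T \<Longrightarrow> j \<in> insert k T \<Longrightarrow> W i j = W j i"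
    and diag: "\<And>i. i \<in> insert k T \<Longrightarrow> W i i = 0"
    and S: "S = (\<Sum>j\<in>T. W k j * exp (u j))" and S_pos: "S > 0"
    and R: "R = (\<Sum>j\<in>T. W k j * (exp (u j) * s j))"
    and u1: "u1 = u(k := ln S - x)" and s1: "s1 = s(k := (R + t) / S)"
begin

lemma exp_u1: "exp (u1 k) = S / exp x" "j \<in> T \<Longrightarrow> u1 j = u j" "j \<in> T \<Longrightarrow> s1 j = s j"
  "exp (u1 k) * s1 k = (R + t) / exp x"
  using S_pos k by (auto simp: u1 s1 exp_diff)

lemma beta_eliminated: "beta (insert k T) W u1 k = exp x / 2"
proof -
  have "(\<Sum>j\<in>T. W k j * exp (u1 j - u1 k)) = (\<Sum>j\<in>T. W k j * exp (u j) / exp (u1 k))"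
    using exp_u1(2) by (intro sum.cong) (auto simp: exp_diff)
  also have "\<dots> = exp x"
    unfolding exp_u1(1) sum_divide_distrib[symmetric] S[symmetric] using S_pos by simp
  finally show ?thesis using fin k diag by (simp add: beta_def)
qed

lemma theta_eliminated: "theta (insert k T) W u1 s1 k = t"
proof -
  have "(\<Sum>j\<in>T. W k j * exp (u1 j) * (s1 k - s1 j)) =
    (\<Sum>j\<in>T. W k j * exp (u j) * s1 k - W k j * (exp (u j) * s j))"
    using exp_u1(2,3) by (intro sum.cong) (auto simp: algebra_simps)
  also have "\<dots> = S * s1 k - R"
    by (simp add: sum_subtractf sum_distrib_right S R)
  also have "\<dots> = t" using S_pos by (simp add: s1)
  finally show ?thesis using fin k diag by (simp add: theta_def)
qed

lemma beta_remaining: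
  assumes i: "i \<in> T"
  shows "beta (insert k T) W u1 i = beta T (eliminate W k (exp x)) u i + (W i k)\<^sup>2 / (2 * exp x)"
proof -
  have "(\<Sum>j\<in>T. eliminate W k (exp x) i j * exp (u j - u i)) =
    (\<Sum>j\<in>T. W i j * exp (u j - u i)) + W i k / exp x * (\<Sum>j\<in>T. W k j * exp (u j - u i))
      - (W i k)\<^sup>2 / exp x"
    using sum_eliminate[OF fin i, of W k "exp x" "\<lambda>j. exp (u j - u i)"] sym diag i by simp
  also have "(\<Sum>j\<in>T. W k j * exp (u j - u i)) = S / exp (u i)"
    by (simp add: S sum_divide_distrib exp_diff)
  finally have e: "(\<Sum>j\<in>T. eliminate W k (exp x) i j * exp (u j - u i)) =
    (\<Sum>j\<in>T. W i j * exp (u j - u i)) + W i k / exp x * (S / exp (u i)) - (W i k)\<^sup>2 / exp x" .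
  have q: "(\<Sum>j\<in>insert k T. W i j * exp (u1 j - u1 i)) =
    W i k * (exp (u1 k) / exp (u i)) + (\<Sum>j\<in>T. W i j * exp (u j - u i))"
    using fin k i exp_u1(2) by (simp add: exp_diff)
  show ?thesis
    unfolding beta_def e q exp_u1(1) by (simp add: field_simps)
qed

lemma theta_remaining:
  assumes i: "i \<in> T"
  shows "theta (insert k T) W u1 s1 i = theta T (eliminate W k (exp x)) u s i - W i k * t / exp x"
proof -
  have "theta T (eliminate W k (exp x)) u s i =
    (\<Sum>j\<in>T. W i j * (exp (u j) * (s i - s j))) + W i k / exp x * (\<Sum>j\<in>T. W k j * (exp (u j) * (s i - s j)))"
    using sum_eliminate[OF fin i, of W k "exp x" "\<lambda>j. exp (u j) * (s i - s j)"] sym diag i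
    by (simp add: theta_def mult.assoc)
  also have "(\<Sum>j\<in>T. W k j * (exp (u j) * (s i - s j))) = S * s i - R"
  proof -
    have "W k j * (exp (u j) * (s i - s j)) = W k j * exp (u j) * s i - W k j * (exp (u j) * s j)" for j
      by (simp add: algebra_simps)
    then show ?thesis by (simp only: sum_subtractf sum_distrib_right[symmetric] S R)
  qed
  finally have e: "theta T (eliminate W k (exp x)) u s i =
    (\<Sum>j\<in>T. W i j * (exp (u j) * (s i - s j))) + W i k / exp x * (S * s i - R)" .
  have q: "theta (insert k T) W u1 s1 i =
    W i k * (exp (u1 k) * s i - exp (u1 k) * s1 k) + (\<Sum>j\<in>T. W i j * (exp (u j) * (s i - s j)))"
    using fin k i exp_u1(2,3) by (simp add: theta_def algebra_simps)
  show ?thesis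
    unfolding e q right_diff_distrib exp_u1(4) unfolding exp_u1(1) by (simp add: field_simps)
qed

text \<open>The quadratic form in \<open>s\<close> completes to a square at \<open>k\<close>, leaving \<open>t\<^sup>2 / (2 y)\<close>. The remaining terms come from
  the row of \<open>k\<close> and from the constant \<open>- 1\<close> in each summand, which turns the new weights into
  \<open>D\<^sup>2 / (2 y)\<close>.\<close>

lemma energy_eliminate:
  fixes D :: real
  defines "D \<equiv> (\<Sum>j\<in>T. W k j)"
  shows "energy (insert k T) W u1 s1 =
    energy T (eliminate W k (exp x)) u s + exp x / 2 - D + (D\<^sup>2 + t\<^sup>2) / (2 * exp x)"
proof -
  let ?y = "exp x"
  define g where "g u s i j = exp (u j) / exp (u i) - 1 + exp (u i) * exp (u j) * (s i)\<^sup>2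
    - exp (u i) * s i * (exp (u j) * s j)" for u s :: "'a \<Rightarrow> real" and i j
  have E1: "2 * energy (insert k T) W u1 s1 = (\<Sum>i\<in>insert k T. \<Sum>j\<in>insert k T. W i j * g u1 s1 i j)"
    unfolding g_def using energy_asymmetric[of "insert k T" W u1 s1] sym by simp
  have E2: "2 * energy T (eliminate W k ?y) u s = (\<Sum>i\<in>T. \<Sum>j\<in>T. eliminate W k ?y i j * g u s i j)"
  proof -
    have "eliminate W k ?y i j = eliminate W k ?y j i" if "i \<in> T" "j \<in> T" for i j
      using that sym[of i j] sym[of i k] sym[of j k] by (simp add: eliminate_def)
    from energy_asymmetric[of T "eliminate W k ?y" u s, OF this] show ?thesis by (simp add: g_def)
  qed
  define M where "M = (\<Sum>i\<in>T. W k i * (S / exp (u i) + S * (exp (u i) * (s i)\<^sup>2)))"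
  define G where "G = (\<Sum>i\<in>T. \<Sum>j\<in>T. W i j * g u s i j)"
  have row: "(\<Sum>j\<in>T. W k j * g u s i j) = S / exp (u i) - D + S * (exp (u i) * (s i)\<^sup>2) - R * (exp (u i) * s i)" for i
  proof -
    have "W k j * g u s i j = W k j * exp (u j) / exp (u i) - W k j
      + W k j * exp (u j) * (exp (u i) * (s i)\<^sup>2) - W k j * (exp (u j) * s j) * (exp (u i) * s i)" for j
      by (simp add: g_def algebra_simps)
    then show ?thesis
      by (simp only: sum.distrib sum_subtractf sum_distrib_right[symmetric] sum_divide_distrib[symmetric]
          S[symmetric] D_def[symmetric] R[symmetric])
  qed
  have "(\<Sum>i\<in>T. \<Sum>j\<in>T. eliminate W k ?y i j * g u s i j) =
    (\<Sum>i\<in>T. (\<Sum>j\<in>T. W i j * g u s i j) + W k i / ?y * (\<Sum>j\<in>T. W k j * g u s i j))"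
  proof (intro sum.cong refl)
    fix i assume i: "i \<in> T"
    have "g u s i i = 0" by (simp add: g_def power2_eq_square)
    then show "(\<Sum>j\<in>T. eliminate W k ?y i j * g u s i j) =
      (\<Sum>j\<in>T. W i j * g u s i j) + W k i / ?y * (\<Sum>j\<in>T. W k j * g u s i j)"
      using sum_eliminate[OF fin i, of W k ?y "g u s i"] sym[of i k] diag i by simp
  qed
  also have "\<dots> = G + (\<Sum>i\<in>T. W k i * (S / exp (u i) + S * (exp (u i) * (s i)\<^sup>2)) / ?y
    - D / ?y * W k i - R / ?y * (W k i * (exp (u i) * s i)))"
    unfolding G_def row sum.distrib[symmetric] by (intro sum.cong refl) (simp add: field_simps)
  also have "\<dots> = G + (M - D\<^sup>2 - R\<^sup>2) / ?y"
    unfolding sum_subtractf sum_divide_distrib[symmetric] sum_distrib_left[symmetric]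
      M_def[symmetric] R[symmetric] D_def[symmetric]
    by (simp add: field_simps power2_eq_square)
  finally have elim: "2 * energy T (eliminate W k ?y) u s = G + (M - D\<^sup>2 - R\<^sup>2) / ?y"
    unfolding E2 .
  have c1: "W i k * g u1 s1 i k = W k i * (S / exp (u i) + S * (exp (u i) * (s i)\<^sup>2)) / ?y
      - W k i - (R + t) / ?y * (W k i * (exp (u i) * s i))" if i: "i \<in> T" for i
  proof -
    have gk: "g u1 s1 i k = (S / ?y) / exp (u i) - 1 + exp (u i) * (S / ?y) * (s i)\<^sup>2
      - exp (u i) * s i * ((R + t) / ?y)"
      unfolding g_def exp_u1(1)[symmetric] exp_u1(4)[symmetric] using exp_u1(2,3)[OF i] by simp
    have w: "W i k = W k i" using sym i by blast
    have "c * (a / y / e - 1 + e * (a / y) * z\<^sup>2 - e * z * (r / y)) =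
      c * (a / e + a * (e * z\<^sup>2)) / y - c - r / y * (c * (e * z))" for a c e r y z :: real
      by (simp add: divide_inverse algebra_simps)
    then show ?thesis unfolding gk w .
  qed
  have c2: "W k j * g u1 s1 k j = W k j * exp (u j) * (?y / S) - W k j
      + W k j * exp (u j) * ((R + t)\<^sup>2 / (S * ?y)) - W k j * (exp (u j) * s j) * ((R + t) / ?y)" if j: "j \<in> T" for j
  proof -
    have quad: "exp (u1 k) * (s1 k)\<^sup>2 = (R + t)\<^sup>2 / (S * ?y)"
      using S_pos unfolding exp_u1(1) by (simp add: s1 power_divide power2_eq_square)
    have gk: "g u1 s1 k j = exp (u1 j) / exp (u1 k) - 1 + exp (u1 j) * (exp (u1 k) * (s1 k)\<^sup>2)
      - exp (u1 k) * s1 k * (exp (u1 j) * s1 j)" by (simp add: g_def)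
    have "w * (e / (S / y) - 1 + e * q - r / y * (e * z)) =
      w * e * (y / S) - w + w * e * q - w * (e * z) * (r / y)" for w e y q r z :: real
      by (simp add: algebra_simps)
    then show ?thesis
      unfolding gk quad exp_u1(4) exp_u1(2)[OF j] exp_u1(3)[OF j] unfolding exp_u1(1) .
  qed
  have "g u1 s1 i j = g u s i j" if "i \<in> T" "j \<in> T" for i j
    using that by (simp add: g_def exp_u1)
  then have "2 * energy (insert k T) W u1 s1 =
    (\<Sum>j\<in>T. W k j * g u1 s1 k j) + ((\<Sum>i\<in>T. W i k * g u1 s1 i k) + G)"
    unfolding E1 G_def using fin k diag[of k] by (simp add: sum.distrib cong: sum.cong)
  also have "(\<Sum>j\<in>T. W k j * g u1 s1 k j) =
    S * (?y / S) - D + S * ((R + t)\<^sup>2 / (S * ?y)) - R * ((R + t) / ?y)"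
    by (rule trans[OF sum.cong[OF refl c2]], assumption, simp only: sum.distrib sum_subtractf sum_distrib_right[symmetric] S[symmetric] D_def[symmetric]
        R[symmetric])
  also have "(\<Sum>i\<in>T. W i k * g u1 s1 i k) = M / ?y - D - (R + t) / ?y * R"
    by (rule trans[OF sum.cong[OF refl c1]], assumption, simp only: sum_subtractf sum_divide_distrib[symmetric] sum_distrib_left[symmetric] M_def[symmetric]
        D_def[symmetric] R[symmetric])
  also have "S * (?y / S) - D + S * ((R + t)\<^sup>2 / (S * ?y)) - R * ((R + t) / ?y)
      + (M / ?y - D - (R + t) / ?y * R + G) =
    G + (M - D\<^sup>2 - R\<^sup>2) / ?y + ?y - 2 * D + (D\<^sup>2 + t\<^sup>2) / ?y"
  proof -
    have "S * (?y / S) = ?y" "S * ((R + t)\<^sup>2 / (S * ?y)) = (R + t)\<^sup>2 / ?y" using S_pos by simp_all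
    then show ?thesis
      by (simp only:) (simp add: diff_divide_distrib add_divide_distrib power2_eq_square algebra_simps)
  qed
  finally show ?thesis unfolding elim[symmetric] by (simp add: add_divide_distrib)
qed

text \<open>The Schur complement of the weighted Laplacian with respect to \<open>k\<close> is the weighted Laplacian of the
  eliminated weights.\<close>

lemma det_on_A_mat_eliminate:
  assumes V: "V \<subseteq> T"
  shows "det_on (insert k V) (A_mat (insert k T) W u1) =
    S\<^sup>2 / exp x * det_on V (A_mat T (eliminate W k (exp x)) u)"
proof -
  let ?y = "exp x" and ?A = "A_mat (insert k T) W u1"
  have "(\<Sum>j\<in>T. W k j * exp (u1 k + u1 j)) = (\<Sum>j\<in>T. W k j * exp (u j) * exp (u1 k))"
    using exp_u1(2) by (intro sum.cong) (auto simp: exp_add)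
  also have "\<dots> = S\<^sup>2 / ?y"
    unfolding sum_distrib_right[symmetric] S[symmetric] exp_u1(1) by (simp add: power2_eq_square)
  finally have kk: "?A k k = S\<^sup>2 / ?y" using fin k diag by (simp add: A_mat_def)
  have schur: "?A i j - ?A i k * ?A k j / ?A k k = A_mat T (eliminate W k ?y) u i j" if ij: "i \<in> V" "j \<in> V" for i j
  proof -
    have T: "i \<in> T" "j \<in> T" and nk: "i \<noteq> k" "j \<noteq> k" using ij V k by auto
    have "?A i k * ?A k j = W i k * W k j * (exp (u i) * exp (u j)) * (S / ?y)\<^sup>2"
      using nk T exp_u1(2) by (simp add: A_mat_def exp_add exp_u1(1) power2_eq_square)
    then have prod: "?A i k * ?A k j / ?A k k = W i k * W k j * (exp (u i) * exp (u j)) / ?y"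
      unfolding kk using S_pos by (simp add: power2_eq_square)
    show ?thesis
    proof (cases "i = j")
      case False
      then show ?thesis unfolding prod using T exp_u1(2)
        by (simp add: A_mat_def eliminate_def exp_add algebra_simps)
    next
      case True
      have "A_mat T (eliminate W k ?y) u i j = (\<Sum>l\<in>T. eliminate W k ?y i l * (exp (u i) * exp (u l)))"
        using True by (simp add: A_mat_def exp_add)
      also have "\<dots> = (\<Sum>l\<in>T. W i l * (exp (u i) * exp (u l)))
        + W i k / ?y * (\<Sum>l\<in>T. W k l * (exp (u i) * exp (u l))) - (W i k)\<^sup>2 / ?y * (exp (u i) * exp (u i))"
        using sum_eliminate[OF fin T(1), of W k ?y "\<lambda>l. exp (u i) * exp (u l)"] sym diag T by simp
      also have "(\<Sum>l\<in>T. W k l * (exp (u i) * exp (u l))) = exp (u i) * S"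
        by (simp add: S sum_distrib_left algebra_simps)
      also have "(\<Sum>l\<in>T. W i l * (exp (u i) * exp (u l))) + W i k / ?y * (exp (u i) * S) = ?A i j"
        using True fin k T exp_u1(2) by (simp add: A_mat_def exp_add exp_u1(1) mult.commute)
      finally show ?thesis unfolding prod using True sym[of i k] T
        by (simp add: power2_eq_square)
    qed
  qed
  have "finite V" "k \<notin> V" using V fin k finite_subset by auto
  then have "det_on (insert k V) ?A = ?A k k * det_on V (\<lambda>i j. ?A i j - ?A i k * ?A k j / ?A k k)"
    using kk S_pos by (intro det_on_insert_Schur) auto
  also have "det_on V (\<lambda>i j. ?A i j - ?A i k * ?A k j / ?A k k) = det_on V (A_mat T (eliminate W k ?y) u)"
    by (intro det_on_cong schur)
  finally show ?thesis unfolding kk .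
qed

end

text \<open>The division by \<open>S\<close> is the Jacobian of \<open>s\<^sub>k \<mapsto> t\<close>. All powers of \<open>S\<close> and \<open>y\<close> cancel: the
  determinant contributes \<open>S\<^sup>2 / y\<close> and the reference measure \<open>y / S\<close>.\<close>

lemma field_density_eliminate:
  fixes V :: "'a set" and k \<delta> :: 'a and W :: "'a \<Rightarrow> 'a \<Rightarrow> real" and u s :: "'a \<Rightarrow> real" and x t S R :: real
  defines "T \<equiv> insert \<delta> V"
  assumes fin: "finite V" and \<delta>: "\<delta> \<notin> V" and k: "k \<notin> T"
    and sym: "\<And>i j. i \<in> insert k T \<Longrightarrow> j \<in> insert k T \<Longrightarrow> W i j = W j i"
    and diag: "\<And>i. i \<in> insert k T \<Longrightarrow> W i i = 0"
    and S: "S = (\<Sum>j\<in>T. W k j * exp (u j))" and S_pos: "S > 0"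
    and R: "R = (\<Sum>j\<in>T. W k j * (exp (u j) * s j))"
  shows "field_density (insert k V) \<delta> W (u(k := ln S - x)) (s(k := (R + t) / S)) / S =
    elimination_kernel (\<Sum>j\<in>T. W k j) x t * field_density V \<delta> (eliminate W k (exp x)) u s"
proof -
  have fT: "finite T" and VT: "V \<subseteq> T" and i: "insert \<delta> (insert k V) = insert k T" and kV: "k \<notin> V"
    using fin k by (auto simp: T_def)
  let ?D = "\<Sum>j\<in>T. W k j"
  let ?u = "u(k := ln S - x)" and ?s = "s(k := (R + t) / S)" and ?W = "eliminate W k (exp x)"
  have e: "energy (insert k T) W ?u ?s = energy T ?W u s + exp x / 2 - ?D + (?D\<^sup>2 + t\<^sup>2) / (2 * exp x)"
    by (rule energy_eliminate[where T = T and k = k and W = W and u = u and s = s and S = S and R = R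
          and x = x and t = t, OF fT k _ _ S S_pos R refl refl]) (erule (1) sym, erule diag)
  have d: "det_on (insert k V) (A_mat (insert k T) W ?u) = S\<^sup>2 / exp x * det_on V (A_mat T ?W u)"
    by (rule det_on_A_mat_eliminate[where T = T and k = k and W = W and u = u and s = s and S = S and R = R
          and x = x and t = t, OF fT k _ _ S S_pos R refl refl VT]) (erule (1) sym, erule diag)
  have p: "(\<Prod>i\<in>insert k V. exp (- (u(k := ln S - x)) i) / (2 * pi)) =
    (exp x / S) / (2 * pi) * (\<Prod>i\<in>V. exp (- u i) / (2 * pi))"
  proof -
    have "(\<Prod>i\<in>V. exp (- (u(k := ln S - x)) i) / (2 * pi)) = (\<Prod>i\<in>V. exp (- u i) / (2 * pi))"
      using kV by (intro prod.cong) auto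
    moreover have "exp (- (ln S - x)) = exp x / S" using S_pos by (simp add: exp_diff)
    ultimately show ?thesis using fin kV by (simp del: minus_diff_eq)
  qed
  have x: "exp (- (E + exp x / 2 - ?D + (?D\<^sup>2 + t\<^sup>2) / (2 * exp x))) =
    exp (?D - exp x / 2 - (?D\<^sup>2 + t\<^sup>2) / (2 * exp x)) * exp (- E)" for E
    by (simp add: exp_add[symmetric])
  have alg: "S\<^sup>2 / y * d * (K * E) * ((y / S) / (2 * pi) * P) / S = K / (2 * pi) * (d * E * P)"
    if "y > 0" for y d K E P :: real
    using S_pos that by (simp add: field_simps power2_eq_square)
  show ?thesis
    unfolding field_density_def i e d p x elimination_kernel_def T_def[symmetric]
    by (rule alg) simp
qed

section \<open>Integrals of functions of beta and theta\<close>

text \<open>Connectedness is expressed by cuts: this form passes to the eliminated weights without any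
  reasoning about paths.\<close>

definition connected_weights :: "'a set \<Rightarrow> 'a \<Rightarrow> ('a \<Rightarrow> 'a \<Rightarrow> real) \<Rightarrow> bool" where
  "connected_weights V \<delta> W \<longleftrightarrow> finite V \<and> \<delta> \<notin> V \<and>
     (\<forall>i\<in>insert \<delta> V. \<forall>j\<in>insert \<delta> V. W i j = W j i \<and> W i j \<ge> 0) \<and>
     (\<forall>i\<in>insert \<delta> V. W i i = 0) \<and>
     (\<forall>U\<subseteq>V. U \<noteq> {} \<longrightarrow> (\<exists>i\<in>U. \<exists>j\<in>insert \<delta> V - U. W i j > 0))"

abbreviation field_space :: "'a set \<Rightarrow> (('a \<Rightarrow> real) \<times> ('a \<Rightarrow> real)) measure" where
  "field_space V \<equiv> (\<Pi>\<^sub>M i\<in>V. borel) \<Otimes>\<^sub>M (\<Pi>\<^sub>M i\<in>V. borel)"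

definition beta_theta ::
  "'a set \<Rightarrow> 'a \<Rightarrow> ('a \<Rightarrow> 'a \<Rightarrow> real) \<Rightarrow> ('a \<Rightarrow> real) \<Rightarrow> ('a \<Rightarrow> real) \<Rightarrow> ('a \<Rightarrow> real) \<times> ('a \<Rightarrow> real)" where
  "beta_theta V \<delta> W u s =
     (\<lambda>i\<in>V. beta (insert \<delta> V) W u i, \<lambda>i\<in>V. theta (insert \<delta> V) W u s i)"

text \<open>The expectation of a function of \<open>\<beta>\<close> and \<open>\<theta>\<close>, with the value \<open>0\<close> of the fields at \<open>\<delta>\<close> filled in.\<close>

definition field_integral ::
  "'a set \<Rightarrow> 'a \<Rightarrow> ('a \<Rightarrow> 'a \<Rightarrow> real) \<Rightarrow> (('a \<Rightarrow> real) \<times> ('a \<Rightarrow> real) \<Rightarrow> ennreal) \<Rightarrow> ennreal" where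
  "field_integral V \<delta> W F = (\<integral>\<^sup>+\<omega>. ennreal (field_density V \<delta> W ((fst \<omega>)(\<delta> := 0)) ((snd \<omega>)(\<delta> := 0))) *
     F (beta_theta V \<delta> W ((fst \<omega>)(\<delta> := 0)) ((snd \<omega>)(\<delta> := 0)))
     \<partial>((\<Pi>\<^sub>M i\<in>V. lborel) \<Otimes>\<^sub>M (\<Pi>\<^sub>M i\<in>V. lborel)))"

text \<open>The weights may depend on \<open>\<omega>\<close> because the eliminated weights depend on the integration
  variable \<open>x\<close>.\<close>

lemma measurable_field_density:
  assumes fin: "finite V"
    and W: "\<And>i j. i \<in> insert \<delta> V \<Longrightarrow> j \<in> insert \<delta> V \<Longrightarrow> (\<lambda>\<omega>. W \<omega> i j) \<in> borel_measurable M"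
    and u: "\<And>i. i \<in> insert \<delta> V \<Longrightarrow> (\<lambda>\<omega>. u \<omega> i) \<in> borel_measurable M"
    and s: "\<And>i. i \<in> insert \<delta> V \<Longrightarrow> (\<lambda>\<omega>. s \<omega> i) \<in> borel_measurable M"
  shows "(\<lambda>\<omega>. field_density V \<delta> (W \<omega>) (u \<omega>) (s \<omega>)) \<in> borel_measurable M"
proof -
  have A: "(\<lambda>\<omega>. A_mat (insert \<delta> V) (W \<omega>) (u \<omega>) i j) \<in> borel_measurable M"
    if "i \<in> V" "j \<in> V" for i j
  proof (cases "i = j")
    case True
    then show ?thesis unfolding A_mat_def using that
      by (auto intro!: borel_measurable_sum borel_measurable_times W u borel_measurable_add
          measurable_compose[OF _ borel_measurable_exp])
  next
    case False
    then show ?thesis unfolding A_mat_def using that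
      by (auto intro!: borel_measurable_times W u borel_measurable_add borel_measurable_uminus
          measurable_compose[OF _ borel_measurable_exp])
  qed
  have det: "(\<lambda>\<omega>. det_on V (A_mat (insert \<delta> V) (W \<omega>) (u \<omega>))) \<in> borel_measurable M"
    unfolding det_on_def
    by (intro borel_measurable_sum borel_measurable_times borel_measurable_const borel_measurable_prod A)
      (auto simp: permutes_in_image)
  have energy: "(\<lambda>\<omega>. energy (insert \<delta> V) (W \<omega>) (u \<omega>) (s \<omega>)) \<in> borel_measurable M"
    unfolding energy_def
    by (intro borel_measurable_sum borel_measurable_times borel_measurable_const borel_measurable_add
        borel_measurable_diff borel_measurable_power W u s measurable_compose[OF _ borel_measurable_cosh]
        measurable_compose[OF _ borel_measurable_exp]) auto
  show ?thesis
    unfolding field_density_def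
    by (intro borel_measurable_times borel_measurable_prod borel_measurable_divide borel_measurable_const
        borel_measurable_uminus u det measurable_compose[OF _ borel_measurable_exp] energy) auto
qed

lemma measurable_beta_theta:
  assumes W: "\<And>i j. i \<in> insert \<delta> V \<Longrightarrow> j \<in> insert \<delta> V \<Longrightarrow> (\<lambda>\<omega>. W \<omega> i j) \<in> borel_measurable M"
    and u: "\<And>i. i \<in> insert \<delta> V \<Longrightarrow> (\<lambda>\<omega>. u \<omega> i) \<in> borel_measurable M"
    and s: "\<And>i. i \<in> insert \<delta> V \<Longrightarrow> (\<lambda>\<omega>. s \<omega> i) \<in> borel_measurable M"
  shows "(\<lambda>\<omega>. beta_theta V \<delta> (W \<omega>) (u \<omega>) (s \<omega>)) \<in> M \<rightarrow>\<^sub>M field_space V"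
  unfolding beta_theta_def beta_def theta_def
  by (intro measurable_Pair measurable_restrict borel_measurable_sum borel_measurable_times
      borel_measurable_const borel_measurable_diff W u s measurable_compose[OF _ borel_measurable_exp]) auto

lemma measurable_extended_coordinate:
  assumes "i \<in> insert \<delta> V"
  shows "(\<lambda>u. (u(\<delta> := 0)) i) \<in> borel_measurable (\<Pi>\<^sub>M i\<in>V. (lborel :: real measure))"
  using assms by (cases "i = \<delta>") (auto intro: measurable_component_singleton[of _ _ "\<lambda>_. (lborel :: real measure)", simplified])

lemma connected_weights_neighbour_sum_pos:
  assumes "connected_weights (insert k V) \<delta> W" "k \<notin> V" and f: "\<And>j. j \<in> insert \<delta> V \<Longrightarrow> f j > 0"
  shows "(\<Sum>j\<in>insert \<delta> V. W k j * f j) > (0::real)"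
proof -
  have "\<exists>i\<in>{k}. \<exists>j\<in>insert \<delta> (insert k V) - {k}. W i j > 0"
    using assms(1) unfolding connected_weights_def by blast
  then obtain j where j: "j \<in> insert \<delta> V" "W k j > 0" by auto
  show ?thesis
  proof (rule sum_pos2[of _ j])
    show "finite (insert \<delta> V)" using assms(1) by (simp add: connected_weights_def)
    show "0 \<le> W k i * f i" if "i \<in> insert \<delta> V" for i
    proof -
      have "W k i \<ge> 0" using assms(1) that unfolding connected_weights_def by blast
      then show ?thesis using f[OF that] by simp
    qed
  qed (use j f in auto)
qed

interpretation lborel_product: product_sigma_finite "\<lambda>_. (lborel :: real measure)"
  by standard

lemma sigma_finite_PiM_lborel: "finite V \<Longrightarrow> sigma_finite_measure (\<Pi>\<^sub>M i\<in>V. (lborel :: real measure))"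
  by (rule lborel_product.sigma_finite)

text \<open>The coordinates at \<open>k\<close> are moved innermost, so that they can be substituted with all other coordinates
  fixed.\<close>

lemma nn_integral_pair_PiM_insert:
  fixes G :: "('a \<Rightarrow> real) \<times> ('a \<Rightarrow> real) \<Rightarrow> ennreal"
  assumes fin: "finite V" and k: "k \<notin> V"
    and G[measurable]: "G \<in> borel_measurable ((\<Pi>\<^sub>M i\<in>insert k V. lborel) \<Otimes>\<^sub>M (\<Pi>\<^sub>M i\<in>insert k V. lborel))"
  shows "(\<integral>\<^sup>+\<omega>. G \<omega> \<partial>((\<Pi>\<^sub>M i\<in>insert k V. lborel) \<Otimes>\<^sub>M (\<Pi>\<^sub>M i\<in>insert k V. lborel))) =
    (\<integral>\<^sup>+u. \<integral>\<^sup>+s. \<integral>\<^sup>+a. \<integral>\<^sup>+b. G (u(k := a), s(k := b)) \<partial>lborel \<partial>lborel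
      \<partial>(\<Pi>\<^sub>M i\<in>V. lborel) \<partial>(\<Pi>\<^sub>M i\<in>V. lborel))"
proof -
  let ?P = "\<Pi>\<^sub>M i\<in>V. (lborel :: real measure)" and ?Q = "\<Pi>\<^sub>M i\<in>insert k V. lborel :: real measure"
  interpret P: sigma_finite_measure ?P by (rule sigma_finite_PiM_lborel[OF fin])
  interpret Q: sigma_finite_measure ?Q by (rule sigma_finite_PiM_lborel) (use fin in simp)
  interpret PL: pair_sigma_finite ?P "lborel :: real measure" by standard
  have upd[measurable]: "(\<lambda>p. (fst p)(k := snd p)) \<in> ?P \<Otimes>\<^sub>M (lborel :: real measure) \<rightarrow>\<^sub>M ?Q"
    by (rule measurable_fun_upd[where J = V]) auto
  have upd1: "(\<lambda>\<omega>. (f \<omega>)(k := g \<omega>)) \<in> M \<rightarrow>\<^sub>M ?Q" if "f \<in> M \<rightarrow>\<^sub>M ?P" "g \<in> borel_measurable M" for f g and M :: "'z measure"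
    using measurable_compose[OF measurable_Pair[OF that(1), of g lborel] upd] that by simp
  have upd2: "(\<lambda>a. u(k := a)) \<in> borel \<rightarrow>\<^sub>M ?Q" if "u \<in> space ?P" for u
    by (intro upd1) (use that in auto)
  have "(\<integral>\<^sup>+\<omega>. G \<omega> \<partial>(?Q \<Otimes>\<^sub>M ?Q)) = (\<integral>\<^sup>+u. \<integral>\<^sup>+s. G (u, s) \<partial>?Q \<partial>?Q)"
    by (rule Q.nn_integral_fst[symmetric]) (rule G)
  also have "\<dots> = (\<integral>\<^sup>+u. \<integral>\<^sup>+a. \<integral>\<^sup>+s. G (u(k := a), s) \<partial>?Q \<partial>lborel \<partial>?P)"
    by (rule lborel_product.product_nn_integral_insert[OF fin k]) measurable
  also have "\<dots> = (\<integral>\<^sup>+u. \<integral>\<^sup>+a. \<integral>\<^sup>+s. \<integral>\<^sup>+b. G (u(k := a), s(k := b)) \<partial>lborel \<partial>?P \<partial>lborel \<partial>?P)"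
  proof (intro nn_integral_cong)
    fix u a assume u: "u \<in> space ?P" and a: "a \<in> space (lborel :: real measure)"
    have ua: "u(k := a) \<in> space ?Q" using measurable_space[OF upd2[OF u], of a] by simp
    have [measurable]: "(\<lambda>s. G (u(k := a), s)) \<in> borel_measurable ?Q"
      using ua by measurable
    show "(\<integral>\<^sup>+s. G (u(k := a), s) \<partial>?Q) = (\<integral>\<^sup>+s. \<integral>\<^sup>+b. G (u(k := a), s(k := b)) \<partial>lborel \<partial>?P)"
      by (rule lborel_product.product_nn_integral_insert[OF fin k]) measurable
  qed
  also have "\<dots> = (\<integral>\<^sup>+u. \<integral>\<^sup>+s. \<integral>\<^sup>+a. \<integral>\<^sup>+b. G (u(k := a), s(k := b)) \<partial>lborel \<partial>lborel \<partial>?P \<partial>?P)"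
  proof (intro nn_integral_cong)
    fix u assume u: "u \<in> space ?P"
    have [measurable]: "(\<lambda>q. G (u(k := snd (fst q)), (fst (fst q))(k := snd q))) \<in>
        borel_measurable ((?P \<Otimes>\<^sub>M (lborel :: real measure)) \<Otimes>\<^sub>M (lborel :: real measure))"
      by (intro measurable_compose[OF _ G] measurable_Pair upd1 measurable_compose[OF _ upd2[OF u]]) measurable
    show "(\<integral>\<^sup>+a. \<integral>\<^sup>+s. \<integral>\<^sup>+b. G (u(k := a), s(k := b)) \<partial>lborel \<partial>?P \<partial>lborel) =
      (\<integral>\<^sup>+s. \<integral>\<^sup>+a. \<integral>\<^sup>+b. G (u(k := a), s(k := b)) \<partial>lborel \<partial>lborel \<partial>?P)"
    proof (rule PL.Fubini')
      have "(\<lambda>p. \<integral>\<^sup>+b. G (u(k := snd p), (fst p)(k := b)) \<partial>lborel) \<in> borel_measurable (?P \<Otimes>\<^sub>M (lborel :: real measure))"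
        by measurable
      then show "(\<lambda>(s, a). \<integral>\<^sup>+b. G (u(k := a), s(k := b)) \<partial>lborel) \<in> borel_measurable (?P \<Otimes>\<^sub>M (lborel :: real measure))"
        by (simp add: split_beta')
    qed
  qed
  finally show ?thesis .
qed

section \<open>Integrating out a vertex\<close>

text \<open>Recovers \<open>\<beta>\<close> and \<open>\<theta>\<close> of the full model from those of the eliminated one.\<close>

definition restore_vertex ::
  "'a set \<Rightarrow> ('a \<Rightarrow> 'a \<Rightarrow> real) \<Rightarrow> 'a \<Rightarrow> real \<Rightarrow> real \<Rightarrow> ('a \<Rightarrow> real) \<times> ('a \<Rightarrow> real) \<Rightarrow> ('a \<Rightarrow> real) \<times> ('a \<Rightarrow> real)" where
  "restore_vertex V W k x t = (\<lambda>(b, c).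
     ((\<lambda>i\<in>V. b i + (W i k)\<^sup>2 / (2 * exp x))(k := exp x / 2), (\<lambda>i\<in>V. c i - W i k * t / exp x)(k := t)))"

lemma measurable_field_space_fun_upd:
  assumes "f \<in> M \<rightarrow>\<^sub>M (\<Pi>\<^sub>M i\<in>V. (borel :: real measure))" "g \<in> borel_measurable M"
  shows "(\<lambda>\<omega>. (f \<omega>)(k := g \<omega>)) \<in> M \<rightarrow>\<^sub>M (\<Pi>\<^sub>M i\<in>insert k V. (borel :: real measure))"
  by (rule measurable_fun_upd[where J = V]) (use assms in auto)

lemma measurable_restore_vertex:
  assumes X: "X \<in> borel_measurable M" and Y: "Y \<in> borel_measurable M" and Z: "Z \<in> M \<rightarrow>\<^sub>M field_space V"
  shows "(\<lambda>\<omega>. restore_vertex V W k (X \<omega>) (Y \<omega>) (Z \<omega>)) \<in> M \<rightarrow>\<^sub>M field_space (insert k V)"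
proof -
  have c: "(\<lambda>\<omega>. fst (Z \<omega>) i) \<in> borel_measurable M" "(\<lambda>\<omega>. snd (Z \<omega>) i) \<in> borel_measurable M" if "i \<in> V" for i
    using measurable_compose[OF measurable_compose[OF Z measurable_fst] measurable_component_singleton[OF that]]
      measurable_compose[OF measurable_compose[OF Z measurable_snd] measurable_component_singleton[OF that]]
    by auto
  show ?thesis
    unfolding restore_vertex_def split_beta
    by (intro measurable_Pair measurable_field_space_fun_upd measurable_restrict borel_measurable_add borel_measurable_diff
        borel_measurable_times borel_measurable_divide borel_measurable_const measurable_compose[OF X borel_measurable_exp]
        X Y c)
qed

lemma beta_theta_eliminate:
  fixes V :: "'a set" and k \<delta> :: 'a and W :: "'a \<Rightarrow> 'a \<Rightarrow> real" and u s :: "'a \<Rightarrow> real" and x t S R :: real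
  defines "T \<equiv> insert \<delta> V"
  assumes fin: "finite V" and \<delta>: "\<delta> \<notin> V" and k: "k \<notin> T"
    and sym: "\<And>i j. i \<in> insert k T \<Longrightarrow> j \<in> insert k T \<Longrightarrow> W i j = W j i"
    and diag: "\<And>i. i \<in> insert k T \<Longrightarrow> W i i = 0"
    and S: "S = (\<Sum>j\<in>T. W k j * exp (u j))" and S_pos: "S > 0"
    and R: "R = (\<Sum>j\<in>T. W k j * (exp (u j) * s j))"
  shows "beta_theta (insert k V) \<delta> W (u(k := ln S - x)) (s(k := (R + t) / S)) =
    restore_vertex V W k x t (beta_theta V \<delta> (eliminate W k (exp x)) u s)"
proof -
  let ?u = "u(k := ln S - x)" and ?s = "s(k := (R + t) / S)" and ?W = "eliminate W k (exp x)"
  have fT: "finite T" and i: "insert \<delta> (insert k V) = insert k T" and kV: "k \<notin> V"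
    using fin k by (auto simp: T_def)
  have bk: "beta (insert k T) W ?u k = exp x / 2"
    by (rule beta_eliminated[where T = T and k = k and W = W and u = u and s = s and S = S and R = R
          and x = x and t = t, OF fT k _ _ S S_pos R refl refl]) (erule (1) sym, erule diag)
  have tk: "theta (insert k T) W ?u ?s k = t"
    by (rule theta_eliminated[where T = T and k = k and W = W and u = u and s = s and S = S and R = R
          and x = x and t = t, OF fT k _ _ S S_pos R refl refl]) (erule (1) sym, erule diag)
  have bi: "beta (insert k T) W ?u i = beta T ?W u i + (W i k)\<^sup>2 / (2 * exp x)" if "i \<in> V" for i
    by (rule beta_remaining[where T = T and k = k and W = W and u = u and s = s and S = S and R = R
          and x = x and t = t, OF fT k _ _ S S_pos R refl refl])
      (erule (1) sym, erule diag, use that in \<open>simp add: T_def\<close>)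
  have ti: "theta (insert k T) W ?u ?s i = theta T ?W u s i - W i k * t / exp x" if "i \<in> V" for i
    by (rule theta_remaining[where T = T and k = k and W = W and u = u and s = s and S = S and R = R
          and x = x and t = t, OF fT k _ _ S S_pos R refl refl])
      (erule (1) sym, erule diag, use that in \<open>simp add: T_def\<close>)
  show ?thesis
    unfolding beta_theta_def restore_vertex_def i T_def[symmetric] using kV
    by (auto simp: fun_eq_iff bk tk bi ti)
qed

lemma nn_integral_lborel_reflect_shift:
  fixes f :: "real \<Rightarrow> ennreal"
  assumes "f \<in> borel_measurable borel"
  shows "(\<integral>\<^sup>+a. f a \<partial>lborel) = (\<integral>\<^sup>+x. f (c - x) \<partial>lborel)"
  using nn_integral_real_affine[OF assms, of "-1" c] by simp

lemma nn_integral_lborel_rescale: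
  fixes f :: "real \<Rightarrow> ennreal" and R S :: real
  assumes "f \<in> borel_measurable borel" "S > 0"
  shows "(\<integral>\<^sup>+b. f b \<partial>lborel) = (\<integral>\<^sup>+t. ennreal (1 / S) * f ((R + t) / S) \<partial>lborel)"
proof -
  have "(\<integral>\<^sup>+b. f b \<partial>lborel) = ennreal (1 / S) * (\<integral>\<^sup>+t. f ((R + t) / S) \<partial>lborel)"
    using nn_integral_real_affine[OF assms(1), of "1 / S" "R / S"] assms(2) by (simp add: add_divide_distrib)
  also have "\<dots> = (\<integral>\<^sup>+t. ennreal (1 / S) * f ((R + t) / S) \<partial>lborel)"
    by (intro nn_integral_cmult[symmetric])
      (use measurable_compose[OF _ assms(1), of "\<lambda>t. (R + t) / S" lborel] in simp)
  finally show ?thesis .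
qed

lemma measurable_elimination_kernel [measurable]:
  "(\<lambda>p. elimination_kernel D (fst p) (snd p)) \<in> borel_measurable (borel \<Otimes>\<^sub>M borel)"
  unfolding elimination_kernel_def by measurable

text \<open>For fixed fields at the other vertices, substitute \<open>u\<^sub>k = ln S - x\<close> and then \<open>s\<^sub>k = (R + t) / S\<close>;
  afterwards Tonelli's theorem moves \<open>x\<close> and \<open>t\<close> outermost.\<close>

theorem field_integral_eliminate:
  assumes W: "connected_weights (insert k V) \<delta> W" and k: "k \<notin> V"
    and F: "F \<in> borel_measurable (field_space (insert k V))"
  shows "field_integral (insert k V) \<delta> W F =
    (\<integral>\<^sup>+x. \<integral>\<^sup>+t. ennreal (elimination_kernel (\<Sum>j\<in>insert \<delta> V. W k j) x t) *
       field_integral V \<delta> (eliminate W k (exp x)) (\<lambda>z. F (restore_vertex V W k x t z)) \<partial>lborel \<partial>lborel)"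
proof -
  let ?P = "\<Pi>\<^sub>M i\<in>V. (lborel :: real measure)" and ?Q = "\<Pi>\<^sub>M i\<in>insert k V. (lborel :: real measure)"
  let ?L = "lborel :: real measure"
  let ?D = "\<Sum>j\<in>insert \<delta> V. W k j"
  have fin: "finite V" and \<delta>: "\<delta> \<notin> V" "\<delta> \<noteq> k" using W by (auto simp: connected_weights_def)
  have sym: "W i j = W j i" if "i \<in> insert k (insert \<delta> V)" "j \<in> insert k (insert \<delta> V)" for i j
    using W that unfolding connected_weights_def by blast
  have diag: "W i i = 0" if "i \<in> insert k (insert \<delta> V)" for i
    using W that unfolding connected_weights_def by blast
  have kT: "k \<notin> insert \<delta> V" using k \<delta> by auto
  interpret P: sigma_finite_measure ?P by (rule sigma_finite_PiM_lborel[OF fin])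
  interpret PP: pair_sigma_finite ?P ?P by standard
  interpret PPLL: pair_sigma_finite "?P \<Otimes>\<^sub>M ?P" "?L \<Otimes>\<^sub>M ?L" by (intro pair_sigma_finite.intro
        PP.sigma_finite_measure_axioms lborel_pair.sigma_finite_measure_axioms | rule PP.P.sigma_finite_measure_axioms)+
  define G where "G \<omega> = ennreal (field_density (insert k V) \<delta> W ((fst \<omega>)(\<delta> := 0)) ((snd \<omega>)(\<delta> := 0))) *
     F (beta_theta (insert k V) \<delta> W ((fst \<omega>)(\<delta> := 0)) ((snd \<omega>)(\<delta> := 0)))" for \<omega>
  define H where "H u s x t = ennreal (elimination_kernel ?D x t) *
    (ennreal (field_density V \<delta> (eliminate W k (exp x)) (u(\<delta> := 0)) (s(\<delta> := 0))) *
     F (restore_vertex V W k x t (beta_theta V \<delta> (eliminate W k (exp x)) (u(\<delta> := 0)) (s(\<delta> := 0)))))" for u s x t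
  have G: "G \<in> borel_measurable (?Q \<Otimes>\<^sub>M ?Q)"
    unfolding G_def
    by (intro borel_measurable_times_ennreal measurable_compose[OF measurable_field_density measurable_ennreal]
        measurable_compose[OF measurable_beta_theta F] measurable_compose[OF measurable_fst]
        measurable_compose[OF measurable_snd] measurable_extended_coordinate) (use fin in auto)
  have pr: "(\<lambda>q. fst (fst q)) \<in> (?P \<Otimes>\<^sub>M ?P) \<Otimes>\<^sub>M (?L \<Otimes>\<^sub>M ?L) \<rightarrow>\<^sub>M ?P"
    "(\<lambda>q. snd (fst q)) \<in> (?P \<Otimes>\<^sub>M ?P) \<Otimes>\<^sub>M (?L \<Otimes>\<^sub>M ?L) \<rightarrow>\<^sub>M ?P"
    by measurable
  have co: "(\<lambda>q. ((fst (fst q))(\<delta> := 0)) i) \<in> borel_measurable ((?P \<Otimes>\<^sub>M ?P) \<Otimes>\<^sub>M (?L \<Otimes>\<^sub>M ?L))"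
    "(\<lambda>q. ((snd (fst q))(\<delta> := 0)) i) \<in> borel_measurable ((?P \<Otimes>\<^sub>M ?P) \<Otimes>\<^sub>M (?L \<Otimes>\<^sub>M ?L))"
    if "i \<in> insert \<delta> V" for i
    by (rule measurable_compose[OF pr(1) measurable_extended_coordinate[OF that]]
        measurable_compose[OF pr(2) measurable_extended_coordinate[OF that]])+
  have xm: "(\<lambda>q. fst (snd q)) \<in> borel_measurable ((?P \<Otimes>\<^sub>M ?P) \<Otimes>\<^sub>M (?L \<Otimes>\<^sub>M ?L))"
    "(\<lambda>q. snd (snd q)) \<in> borel_measurable ((?P \<Otimes>\<^sub>M ?P) \<Otimes>\<^sub>M (?L \<Otimes>\<^sub>M ?L))"
    by measurable
  have el: "(\<lambda>q. eliminate W k (exp (fst (snd q))) i j) \<in> borel_measurable ((?P \<Otimes>\<^sub>M ?P) \<Otimes>\<^sub>M (?L \<Otimes>\<^sub>M ?L))" for i j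
    unfolding eliminate_def using xm(1) by (cases "i = j") auto
  have H: "(\<lambda>q. H (fst (fst q)) (snd (fst q)) (fst (snd q)) (snd (snd q))) \<in>
      borel_measurable ((?P \<Otimes>\<^sub>M ?P) \<Otimes>\<^sub>M (?L \<Otimes>\<^sub>M ?L))"
    unfolding H_def
    by (intro borel_measurable_times_ennreal measurable_compose[OF measurable_field_density measurable_ennreal]
        measurable_compose[OF measurable_restore_vertex[OF xm measurable_beta_theta] F] el co
        measurable_compose[OF measurable_compose[OF measurable_snd] measurable_compose[OF measurable_elimination_kernel measurable_ennreal]]
        fin) auto
  have one_vertex: "(\<integral>\<^sup>+a. \<integral>\<^sup>+b. G (u(k := a), s(k := b)) \<partial>lborel \<partial>lborel) = (\<integral>\<^sup>+x. \<integral>\<^sup>+t. H u s x t \<partial>lborel \<partial>lborel)"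
    if u: "u \<in> space ?P" and s: "s \<in> space ?P" for u s
  proof -
    let ?u = "u(\<delta> := 0)" and ?s = "s(\<delta> := 0)"
    define S where "S = (\<Sum>j\<in>insert \<delta> V. W k j * exp (?u j))"
    define R where "R = (\<Sum>j\<in>insert \<delta> V. W k j * (exp (?u j) * ?s j))"
    have S_pos: "S > 0" unfolding S_def by (rule connected_weights_neighbour_sum_pos[OF W k]) simp
    have upd: "(\<lambda>a. w(k := a)) \<in> borel \<rightarrow>\<^sub>M ?Q" if "w \<in> space ?P" for w
      by (rule measurable_fun_upd[where J = V]) (use that in auto)
    have Gm: "(\<lambda>p. G (u(k := fst p), s(k := snd p))) \<in> borel_measurable (?L \<Otimes>\<^sub>M ?L)"
      by (intro measurable_compose[OF _ G] measurable_Pair measurable_compose[OF _ upd[OF u]]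
          measurable_compose[OF _ upd[OF s]]) measurable
    have "(\<integral>\<^sup>+a. \<integral>\<^sup>+b. G (u(k := a), s(k := b)) \<partial>lborel \<partial>lborel) =
      (\<integral>\<^sup>+x. \<integral>\<^sup>+b. G (u(k := ln S - x), s(k := b)) \<partial>lborel \<partial>lborel)"
      using lborel.borel_measurable_nn_integral_fst[OF Gm]
      by (intro nn_integral_lborel_reflect_shift[of "\<lambda>a. \<integral>\<^sup>+b. G (u(k := a), s(k := b)) \<partial>lborel" "ln S"]) simp
    also have "\<dots> = (\<integral>\<^sup>+x. \<integral>\<^sup>+t. ennreal (1 / S) * G (u(k := ln S - x), s(k := (R + t) / S)) \<partial>lborel \<partial>lborel)"
    proof (rule nn_integral_cong)
      fix x :: real
      have "(\<lambda>b. G (u(k := ln S - x), s(k := b))) \<in> borel_measurable borel"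
        using measurable_compose[OF measurable_Pair1'[of "ln S - x" ?L ?L] Gm] by simp
      from nn_integral_lborel_rescale[OF this S_pos, of R]
      show "(\<integral>\<^sup>+b. G (u(k := ln S - x), s(k := b)) \<partial>lborel) =
        (\<integral>\<^sup>+t. ennreal (1 / S) * G (u(k := ln S - x), s(k := (R + t) / S)) \<partial>lborel)" .
    qed
    also have "\<dots> = (\<integral>\<^sup>+x. \<integral>\<^sup>+t. H u s x t \<partial>lborel \<partial>lborel)"
    proof (intro nn_integral_cong)
      fix x t :: real
      let ?u1 = "?u(k := ln S - x)" and ?s1 = "?s(k := (R + t) / S)"
      have c: "(u(k := ln S - x))(\<delta> := 0) = ?u1" "(s(k := (R + t) / S))(\<delta> := 0) = ?s1"
        using \<delta>(2) by (simp_all add: fun_upd_twist)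
      have d: "field_density (insert k V) \<delta> W ?u1 ?s1 / S =
        elimination_kernel ?D x t * field_density V \<delta> (eliminate W k (exp x)) ?u ?s"
        by (rule field_density_eliminate[where W = W and u = ?u and s = ?s and S = S and R = R, OF fin \<delta>(1) kT _ _ S_def S_pos R_def]) (erule (1) sym, erule diag)
      have b: "beta_theta (insert k V) \<delta> W ?u1 ?s1 =
        restore_vertex V W k x t (beta_theta V \<delta> (eliminate W k (exp x)) ?u ?s)"
        by (rule beta_theta_eliminate[where W = W and u = ?u and s = ?s and S = S and R = R, OF fin \<delta>(1) kT _ _ S_def S_pos R_def]) (erule (1) sym, erule diag)
      have "ennreal (1 / S) * ennreal (field_density (insert k V) \<delta> W ?u1 ?s1) =
        ennreal (field_density (insert k V) \<delta> W ?u1 ?s1 / S)"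
        using S_pos by (subst ennreal_mult'[symmetric]) simp_all
      also have "\<dots> = ennreal (elimination_kernel ?D x t) *
        ennreal (field_density V \<delta> (eliminate W k (exp x)) ?u ?s)"
        unfolding d by (rule ennreal_mult') (simp add: elimination_kernel_def)
      finally show "ennreal (1 / S) * G (u(k := ln S - x), s(k := (R + t) / S)) = H u s x t"
        unfolding G_def H_def fst_conv snd_conv c b mult.assoc[symmetric] by simp
    qed
    finally show ?thesis .
  qed
  have "field_integral (insert k V) \<delta> W F = (\<integral>\<^sup>+\<omega>. G \<omega> \<partial>(?Q \<Otimes>\<^sub>M ?Q))"
    unfolding field_integral_def G_def ..
  also have "\<dots> = (\<integral>\<^sup>+u. \<integral>\<^sup>+s. \<integral>\<^sup>+x. \<integral>\<^sup>+t. H u s x t \<partial>lborel \<partial>lborel \<partial>?P \<partial>?P)"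
    unfolding nn_integral_pair_PiM_insert[OF fin k G]
    by (intro nn_integral_cong one_vertex)
  also have "\<dots> = (\<integral>\<^sup>+u. \<integral>\<^sup>+s. \<integral>\<^sup>+r. H u s (fst r) (snd r) \<partial>(?L \<Otimes>\<^sub>M ?L) \<partial>?P \<partial>?P)"
  proof (intro nn_integral_cong)
    fix u s assume us: "u \<in> space ?P" "s \<in> space ?P"
    have "(\<lambda>r. H u s (fst r) (snd r)) \<in> borel_measurable (?L \<Otimes>\<^sub>M ?L)"
      using measurable_compose[OF measurable_Pair1'[of "(u, s)" "?P \<Otimes>\<^sub>M ?P" "?L \<Otimes>\<^sub>M ?L"] H] us
      by (simp add: space_pair_measure)
    from lborel.nn_integral_fst[OF this]
    show "(\<integral>\<^sup>+x. \<integral>\<^sup>+t. H u s x t \<partial>lborel \<partial>lborel) = (\<integral>\<^sup>+r. H u s (fst r) (snd r) \<partial>(?L \<Otimes>\<^sub>M ?L))"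
      by simp
  qed
  also have "\<dots> = (\<integral>\<^sup>+\<omega>. \<integral>\<^sup>+r. H (fst \<omega>) (snd \<omega>) (fst r) (snd r) \<partial>(?L \<Otimes>\<^sub>M ?L) \<partial>(?P \<Otimes>\<^sub>M ?P))"
  proof -
    have "(\<lambda>\<omega>. \<integral>\<^sup>+r. H (fst \<omega>) (snd \<omega>) (fst r) (snd r) \<partial>(?L \<Otimes>\<^sub>M ?L)) \<in> borel_measurable (?P \<Otimes>\<^sub>M ?P)"
      using lborel_pair.P.borel_measurable_nn_integral_fst[OF H] by simp
    from P.nn_integral_fst[OF this] show ?thesis by simp
  qed
  also have "\<dots> = (\<integral>\<^sup>+r. \<integral>\<^sup>+\<omega>. H (fst \<omega>) (snd \<omega>) (fst r) (snd r) \<partial>(?P \<Otimes>\<^sub>M ?P) \<partial>(?L \<Otimes>\<^sub>M ?L))"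
    using H by (intro PPLL.Fubini'[symmetric]) (simp add: split_beta')
  also have "\<dots> = (\<integral>\<^sup>+x. \<integral>\<^sup>+t. \<integral>\<^sup>+\<omega>. H (fst \<omega>) (snd \<omega>) x t \<partial>(?P \<Otimes>\<^sub>M ?P) \<partial>lborel \<partial>lborel)"
  proof -
    have "(\<lambda>(\<omega>, r). H (fst \<omega>) (snd \<omega>) (fst r) (snd r)) \<in> borel_measurable ((?P \<Otimes>\<^sub>M ?P) \<Otimes>\<^sub>M (?L \<Otimes>\<^sub>M ?L))"
      using H by (simp add: split_beta')
    from measurable_pair_swap[OF this]
    have "(\<lambda>q. H (fst (snd q)) (snd (snd q)) (fst (fst q)) (snd (fst q))) \<in> borel_measurable ((?L \<Otimes>\<^sub>M ?L) \<Otimes>\<^sub>M (?P \<Otimes>\<^sub>M ?P))"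
      by (simp add: split_beta')
    from PP.P.borel_measurable_nn_integral_fst[OF this]
    have "(\<lambda>r. \<integral>\<^sup>+\<omega>. H (fst \<omega>) (snd \<omega>) (fst r) (snd r) \<partial>(?P \<Otimes>\<^sub>M ?P)) \<in> borel_measurable (?L \<Otimes>\<^sub>M ?L)"
      by simp
    from lborel.nn_integral_fst[OF this] show ?thesis by simp
  qed
  also have "\<dots> = (\<integral>\<^sup>+x. \<integral>\<^sup>+t. ennreal (elimination_kernel ?D x t) *
       field_integral V \<delta> (eliminate W k (exp x)) (\<lambda>z. F (restore_vertex V W k x t z)) \<partial>lborel \<partial>lborel)"
  proof (intro nn_integral_cong)
    fix x t :: real
    have r: "(\<lambda>z. restore_vertex V W k x t z) \<in> field_space V \<rightarrow>\<^sub>M field_space (insert k V)"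
      by (intro measurable_restore_vertex) auto
    have "(\<lambda>\<omega>. ennreal (field_density V \<delta> (eliminate W k (exp x)) ((fst \<omega>)(\<delta> := 0)) ((snd \<omega>)(\<delta> := 0))) *
       F (restore_vertex V W k x t (beta_theta V \<delta> (eliminate W k (exp x)) ((fst \<omega>)(\<delta> := 0)) ((snd \<omega>)(\<delta> := 0)))))
       \<in> borel_measurable (?P \<Otimes>\<^sub>M ?P)"
      by (intro borel_measurable_times_ennreal measurable_compose[OF measurable_field_density measurable_ennreal]
        measurable_compose[OF measurable_compose[OF measurable_beta_theta r] F] measurable_compose[OF measurable_fst]
        measurable_compose[OF measurable_snd] measurable_extended_coordinate) (use fin in auto)
    then show "(\<integral>\<^sup>+\<omega>. H (fst \<omega>) (snd \<omega>) x t \<partial>(?P \<Otimes>\<^sub>M ?P)) = ennreal (elimination_kernel ?D x t) *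
       field_integral V \<delta> (eliminate W k (exp x)) (\<lambda>z. F (restore_vertex V W k x t z))"
      unfolding H_def field_integral_def by (rule nn_integral_cmult)
  qed
  finally show ?thesis .
qed

section \<open>The Laplace transform\<close>

text \<open>If a cut of the remaining vertices is crossed only through \<open>k\<close>, then \<open>k\<close> has neighbours on both of
  its sides, and the elimination joins them directly.\<close>

lemma connected_weights_eliminate:
  assumes W: "connected_weights (insert k V) \<delta> W" and k: "k \<notin> V" and y: "y > 0"
  shows "connected_weights V \<delta> (eliminate W k y)"
proof -
  have fin: "finite V" and \<delta>: "\<delta> \<notin> V" "\<delta> \<noteq> k" using W by (auto simp: connected_weights_def)
  have sym: "W i j = W j i" "W i j \<ge> 0" if "i \<in> insert \<delta> (insert k V)" "j \<in> insert \<delta> (insert k V)" for i j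
    using W that unfolding connected_weights_def by blast+
  have cut: "\<exists>i\<in>U. \<exists>j\<in>insert \<delta> (insert k V) - U. W i j > 0" if "U \<subseteq> insert k V" "U \<noteq> {}" for U
    using W that unfolding connected_weights_def by blast
  have nonneg: "W i k * W k j / y \<ge> 0" if "i \<in> insert \<delta> V" "j \<in> insert \<delta> V" for i j
    using sym(2)[of i k] sym(2)[of k j] that y by auto
  have crossing: "\<exists>i\<in>U. \<exists>j\<in>insert \<delta> V - U. eliminate W k y i j > 0" if U: "U \<subseteq> V" "U \<noteq> {}" for U
  proof (cases "\<exists>i\<in>U. \<exists>j\<in>insert \<delta> V - U. W i j > 0")
    case True
    then obtain i j where ij: "i \<in> U" "j \<in> insert \<delta> V - U" "W i j > 0" by blast
    then have "eliminate W k y i j > 0"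
      using nonneg[of i j] U by (auto simp: eliminate_def intro: add_pos_nonneg)
    then show ?thesis using ij by blast
  next
    case False
    obtain i where i: "i \<in> U" "W i k > 0" using cut[of U] U False by blast
    obtain i' j where "i' \<in> insert k U" "j \<in> insert \<delta> V - U" "j \<noteq> k" "W i' j > 0"
      using cut[of "insert k U"] U by blast
    with False have j: "j \<in> insert \<delta> V - U" "W k j > 0" by auto
    have "W i j \<ge> 0" using i j U by (intro sym(2)) auto
    then have "eliminate W k y i j > 0"
      using i j y by (auto simp: eliminate_def intro!: add_nonneg_pos)
    then show ?thesis using i j by blast
  qed
  have "eliminate W k y i j = eliminate W k y j i \<and> eliminate W k y i j \<ge> 0"
    if "i \<in> insert \<delta> V" "j \<in> insert \<delta> V" for i j
    using sym[of i j] sym(1)[of i k] sym(1)[of k j] nonneg[of i j] that by (auto simp: eliminate_def)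
  then show ?thesis
    unfolding connected_weights_def using fin \<delta> crossing by (auto simp: eliminate_def)
qed

lemma field_integral_cmult:
  assumes fin: "finite V" and F: "F \<in> borel_measurable (field_space V)"
  shows "field_integral V \<delta> W (\<lambda>z. c * F z) = c * field_integral V \<delta> W F"
proof -
  have "(\<lambda>\<omega>. ennreal (field_density V \<delta> W ((fst \<omega>)(\<delta> := 0)) ((snd \<omega>)(\<delta> := 0))) *
      F (beta_theta V \<delta> W ((fst \<omega>)(\<delta> := 0)) ((snd \<omega>)(\<delta> := 0))))
      \<in> borel_measurable ((\<Pi>\<^sub>M i\<in>V. lborel) \<Otimes>\<^sub>M (\<Pi>\<^sub>M i\<in>V. lborel))"
    by (intro borel_measurable_times_ennreal measurable_compose[OF measurable_field_density measurable_ennreal]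
        measurable_compose[OF measurable_beta_theta F] measurable_compose[OF measurable_fst]
        measurable_compose[OF measurable_snd] measurable_extended_coordinate) (use fin in auto)
  then show ?thesis
    unfolding field_integral_def mult.left_commute[of _ c] by (rule nn_integral_cmult)
qed

definition laplace_kernel :: "'a set \<Rightarrow> ('a \<Rightarrow> real) \<Rightarrow> ('a \<Rightarrow> real) \<Rightarrow> ('a \<Rightarrow> real) \<times> ('a \<Rightarrow> real) \<Rightarrow> real" where
  "laplace_kernel V a b = (\<lambda>(B, C).
     exp (- (\<Sum>i\<in>V. ((a i)\<^sup>2 + (b i)\<^sup>2 - 1) * B i) - (\<Sum>i\<in>V. b i * C i)))"

lemma measurable_laplace_kernel [measurable]:
  "laplace_kernel V a b \<in> borel_measurable (field_space V)"
proof -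
  have [measurable]: "(\<lambda>z. fst z i) \<in> borel_measurable (field_space V)"
    "(\<lambda>z. snd z i) \<in> borel_measurable (field_space V)" if "i \<in> V" for i
    using that by measurable
  show ?thesis unfolding laplace_kernel_def split_beta by measurable
qed

text \<open>The bookkeeping for the induction step of the Laplace transform: completing the square in \<open>t\<close> leaves the exponents
  of a Gaussian and of an inverse Gaussian integral, and the constants combine to the sum over
  the larger vertex set. The diagonal terms dropped by the elimination cancel against the shift of
  \<open>\<beta>\<close>.\<close>

lemma elimination_exponent:
  fixes V :: "'a set" and k \<delta> :: 'a and W :: "'a \<Rightarrow> 'a \<Rightarrow> real" and a b :: "'a \<Rightarrow> real" and y t :: real
  defines "T \<equiv> insert \<delta> V"
  defines "A \<equiv> \<Sum>j\<in>T. W k j * a j" and "B \<equiv> \<Sum>j\<in>T. W k j * b j" and "D \<equiv> \<Sum>j\<in>T. W k j"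
  defines "h \<equiv> \<lambda>i j. a i * a j + b i * b j - 1"
  assumes W: "connected_weights (insert k V) \<delta> W" and k: "k \<notin> V" and y: "y > 0"
    and \<delta>: "a \<delta> = 1" "b \<delta> = 0"
  shows "D - y / 2 - (D\<^sup>2 + t\<^sup>2) / (2 * y)
      - (((a k)\<^sup>2 + (b k)\<^sup>2 - 1) * (y / 2) + (\<Sum>i\<in>V. ((a i)\<^sup>2 + (b i)\<^sup>2 - 1) * ((W i k)\<^sup>2 / (2 * y))))
      - (b k * t - (\<Sum>i\<in>V. b i * (W i k * t / y)))
      - 1/2 * (\<Sum>i\<in>T. \<Sum>j\<in>T. eliminate W k y i j * h i j) =
    D - b k * B - 1/2 * (\<Sum>i\<in>T. \<Sum>j\<in>T. W i j * h i j)
      + (- (a k)\<^sup>2 * y / 2 - A\<^sup>2 / (2 * y) - (t + b k * y - B)\<^sup>2 / (2 * y))"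
    and "1/2 * (\<Sum>i\<in>insert k T. \<Sum>j\<in>insert k T. W i j * h i j) =
      1/2 * (\<Sum>i\<in>T. \<Sum>j\<in>T. W i j * h i j) + a k * A + b k * B - D"
proof -
  have fin: "finite V" "finite T" and dV: "\<delta> \<notin> V" and kT: "k \<notin> T"
    using W k by (auto simp: connected_weights_def T_def)
  have sym: "W i j = W j i" if "i \<in> insert k T" "j \<in> insert k T" for i j
    using W that unfolding connected_weights_def T_def by blast
  have diag: "W i i = 0" if "i \<in> insert k T" for i
    using W that unfolding connected_weights_def T_def by blast
  let ?c = "\<lambda>i. (a i)\<^sup>2 + (b i)\<^sup>2 - 1"
  define C where "C = (\<Sum>i\<in>T. ?c i * (W k i)\<^sup>2)"
  define H where "H = (\<Sum>i\<in>T. \<Sum>j\<in>T. W i j * h i j)"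
  have row: "(\<Sum>j\<in>T. W k j * h i j) = a i * A + b i * B - D" for i
  proof -
    have "W k j * h i j = a i * (W k j * a j) + b i * (W k j * b j) - W k j" for j
      by (simp add: h_def algebra_simps)
    then show ?thesis by (simp only: sum.distrib sum_subtractf sum_distrib_left[symmetric] A_def B_def D_def)
  qed
  have cV: "(\<Sum>i\<in>V. ?c i * ((W i k)\<^sup>2 / (2 * y))) = C / (2 * y)"
  proof -
    have "C = (\<Sum>i\<in>V. ?c i * (W k i)\<^sup>2)"
      unfolding C_def T_def using fin dV \<delta> by simp
    also have "\<dots> = (\<Sum>i\<in>V. ?c i * (W i k)\<^sup>2)"
      by (intro sum.cong refl) (metis sym T_def insertCI)
    finally show ?thesis by (simp add: sum_divide_distrib)
  qed
  have bV: "(\<Sum>i\<in>V. b i * (W i k * t / y)) = B * t / y"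
  proof -
    have "B = (\<Sum>i\<in>V. W k i * b i)"
      unfolding B_def T_def using fin dV \<delta> by simp
    also have "\<dots> = (\<Sum>i\<in>V. b i * W i k)"
      by (intro sum.cong refl) (metis sym T_def insertCI mult.commute)
    finally show ?thesis by (simp add: sum_divide_distrib sum_distrib_right mult.assoc)
  qed
  have "(\<Sum>i\<in>T. \<Sum>j\<in>T. eliminate W k y i j * h i j) =
    (\<Sum>i\<in>T. (\<Sum>j\<in>T. W i j * h i j) + W k i / y * (a i * A + b i * B - D) - (W k i)\<^sup>2 / y * ?c i)"
  proof (intro sum.cong refl)
    fix i assume i: "i \<in> T"
    have "h i i = ?c i" by (simp add: h_def power2_eq_square)
    then show "(\<Sum>j\<in>T. eliminate W k y i j * h i j) =
      (\<Sum>j\<in>T. W i j * h i j) + W k i / y * (a i * A + b i * B - D) - (W k i)\<^sup>2 / y * ?c i"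
      using sum_eliminate[OF fin(2) i, of W k y "h i"] sym[of i k] diag i row[of i] by simp
  qed
  also have "\<dots> = H + (\<Sum>i\<in>T. (W k i * a i) * (A / y) + (W k i * b i) * (B / y) - W k i * (D / y) - (?c i * (W k i)\<^sup>2) / y)"
    unfolding H_def sum.distrib[symmetric] by (intro sum.cong refl) (simp add: algebra_simps diff_divide_distrib add_divide_distrib)
  also have "\<dots> = H + (A * (A / y) + B * (B / y) - D * (D / y) - C / y)"
    by (simp only: sum.distrib sum_subtractf sum_distrib_right[symmetric] sum_divide_distrib[symmetric]
        A_def[symmetric] B_def[symmetric] D_def[symmetric] C_def[symmetric])
  finally have el: "(\<Sum>i\<in>T. \<Sum>j\<in>T. eliminate W k y i j * h i j) =
    H + (A * (A / y) + B * (B / y) - D * (D / y) - C / y)" .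
  show "D - y / 2 - (D\<^sup>2 + t\<^sup>2) / (2 * y)
      - (?c k * (y / 2) + (\<Sum>i\<in>V. ?c i * ((W i k)\<^sup>2 / (2 * y))))
      - (b k * t - (\<Sum>i\<in>V. b i * (W i k * t / y)))
      - 1/2 * (\<Sum>i\<in>T. \<Sum>j\<in>T. eliminate W k y i j * h i j) =
    D - b k * B - 1/2 * (\<Sum>i\<in>T. \<Sum>j\<in>T. W i j * h i j)
      + (- (a k)\<^sup>2 * y / 2 - A\<^sup>2 / (2 * y) - (t + b k * y - B)\<^sup>2 / (2 * y))"
    unfolding el cV bV H_def[symmetric] using y by (simp add: field_simps power2_eq_square)
  have "(\<Sum>j\<in>insert k T. W i j * h i j) = W i k * h i k + (\<Sum>j\<in>T. W i j * h i j)" for i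
    using fin kT by simp
  then have "(\<Sum>i\<in>insert k T. \<Sum>j\<in>insert k T. W i j * h i j) =
    (\<Sum>j\<in>T. W k j * h k j) + ((\<Sum>i\<in>T. W i k * h i k) + H)"
    using fin kT diag[of k] by (simp add: sum.distrib H_def)
  also have "(\<Sum>i\<in>T. W i k * h i k) = (\<Sum>i\<in>T. W k i * h k i)"
    by (intro sum.cong refl) (metis sym insertCI h_def mult.commute)
  finally show "1/2 * (\<Sum>i\<in>insert k T. \<Sum>j\<in>insert k T. W i j * h i j) =
      1/2 * (\<Sum>i\<in>T. \<Sum>j\<in>T. W i j * h i j) + a k * A + b k * B - D"
    unfolding row H_def by simp
qed

lemma nn_integral_cmult_inverse_gaussian_gaussian:
  fixes \<alpha> A b m :: real and c :: ennreal
  assumes pos: "\<alpha> > 0" "A > 0"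
  shows "(\<integral>\<^sup>+x. \<integral>\<^sup>+t. c * ennreal (exp (- \<alpha>\<^sup>2 * exp x / 2 - A\<^sup>2 / (2 * exp x)
      - (t + b * exp x - m)\<^sup>2 / (2 * exp x))) \<partial>lborel \<partial>lborel) =
    c * ennreal (2 * pi * exp (- \<alpha> * A) / \<alpha>)"
  unfolding nn_integral_inverse_gaussian_gaussian[OF pos, of b m, symmetric]
  by (simp add: nn_integral_cmult)

text \<open>The double sum runs over ordered pairs, hence the factor \<open>1/2\<close>. Eliminating \<open>k\<close> contributes the factor
  \<open>1 / a k\<close>, as the mass of an inverse Gaussian integral with \<open>\<alpha> = a k\<close> and \<open>A = \<Sum>\<^sub>j W\<^sub>k\<^sub>j a\<^sub>j\<close>; the
  induction hypothesis is needed for the eliminated weights, for every value of \<open>x\<close>.\<close>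

theorem field_integral_laplace_kernel:
  assumes "connected_weights V \<delta> W" and "\<And>i. i \<in> insert \<delta> V \<Longrightarrow> a i > 0" and \<delta>: "a \<delta> = 1" "b \<delta> = 0"
  shows "field_integral V \<delta> W (\<lambda>z. ennreal (laplace_kernel V a b z)) =
    ennreal (exp (- (1/2 * (\<Sum>i\<in>insert \<delta> V. \<Sum>j\<in>insert \<delta> V. W i j * (a i * a j + b i * b j - 1)))) *
      (\<Prod>i\<in>V. 1 / a i))"
proof -
  have "finite V" using assms(1) by (simp add: connected_weights_def)
  then show ?thesis using assms(1,2)
  proof (induction V arbitrary: W)
    case empty
    have "W \<delta> \<delta> = 0" using empty.prems by (simp add: connected_weights_def)
    moreover have "(\<integral>\<^sup>+\<omega>. 1 \<partial>((\<Pi>\<^sub>M i\<in>({}::'a set). (lborel :: real measure)) \<Otimes>\<^sub>M (\<Pi>\<^sub>M i\<in>({}::'a set). (lborel :: real measure)))) = 1"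
    proof -
      interpret P: sigma_finite_measure "\<Pi>\<^sub>M i\<in>({}::'a set). (lborel :: real measure)"
        by (rule sigma_finite_PiM_lborel) simp
      let ?P = "\<Pi>\<^sub>M i\<in>({}::'a set). (lborel :: real measure)"
      have "(\<integral>\<^sup>+u. \<integral>\<^sup>+s. 1 \<partial>?P \<partial>?P) = (\<integral>\<^sup>+\<omega>. 1 \<partial>(?P \<Otimes>\<^sub>M ?P))"
        by (rule P.nn_integral_fst[of "\<lambda>_. 1"]) simp
      then show ?thesis by (simp add: space_PiM_empty)
    qed
    ultimately show ?case
      by (simp add: field_integral_def field_density_def energy_def det_on_def laplace_kernel_def)
  next
    case (insert k V)
    let ?T = "insert \<delta> V"
    let ?A = "\<Sum>j\<in>?T. W k j * a j" and ?B = "\<Sum>j\<in>?T. W k j * b j" and ?D = "\<Sum>j\<in>?T. W k j"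
    let ?h = "\<lambda>i j. a i * a j + b i * b j - 1"
    let ?E = "?D - b k * ?B - 1/2 * (\<Sum>i\<in>?T. \<Sum>j\<in>?T. W i j * ?h i j)"
    let ?P = "\<Prod>i\<in>V. 1 / a i"
    have ak: "a k > 0" and a_pos: "\<And>i. i \<in> ?T \<Longrightarrow> a i > 0" using insert.prems(2) by auto
    have A_pos: "?A > 0"
      by (rule connected_weights_neighbour_sum_pos[OF insert.prems(1) insert.hyps(2)]) (rule a_pos)
    have P_nonneg: "?P \<ge> 0" by (intro prod_nonneg) (use a_pos in \<open>auto intro: less_imp_le\<close>)
    have c_nonneg: "exp ?E * ?P / (2 * pi) \<ge> 0"
      using P_nonneg by (intro divide_nonneg_pos mult_nonneg_nonneg) auto
    have inner: "ennreal (elimination_kernel ?D x t) * field_integral V \<delta> (eliminate W k (exp x))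
        (\<lambda>z. ennreal (laplace_kernel (insert k V) a b (restore_vertex V W k x t z))) =
      ennreal (exp ?E * ?P / (2 * pi)) *
        ennreal (exp (- (a k)\<^sup>2 * exp x / 2 - ?A\<^sup>2 / (2 * exp x) - (t + b k * exp x - ?B)\<^sup>2 / (2 * exp x)))" for x t
    proof -
      let ?p = "((a k)\<^sup>2 + (b k)\<^sup>2 - 1) * (exp x / 2) + (\<Sum>i\<in>V. ((a i)\<^sup>2 + (b i)\<^sup>2 - 1) * ((W i k)\<^sup>2 / (2 * exp x)))"
      let ?q = "b k * t - (\<Sum>i\<in>V. b i * (W i k * t / exp x))"
      let ?S = "\<Sum>i\<in>?T. \<Sum>j\<in>?T. eliminate W k (exp x) i j * ?h i j"
      have split: "laplace_kernel (insert k V) a b (restore_vertex V W k x t z) =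
        exp (- ?p - ?q) * laplace_kernel V a b z" for z
      proof -
        obtain \<beta> \<theta> where z: "z = (\<beta>, \<theta>)" by (cases z)
        have "(\<Sum>i\<in>V. ((a i)\<^sup>2 + (b i)\<^sup>2 - 1) * ((\<lambda>i\<in>V. \<beta> i + (W i k)\<^sup>2 / (2 * exp x))(k := exp x / 2)) i) =
          (\<Sum>i\<in>V. ((a i)\<^sup>2 + (b i)\<^sup>2 - 1) * \<beta> i) + (\<Sum>i\<in>V. ((a i)\<^sup>2 + (b i)\<^sup>2 - 1) * ((W i k)\<^sup>2 / (2 * exp x)))"
          unfolding sum.distrib[symmetric] using insert.hyps
          by (intro sum.cong) (auto simp: distrib_left)
        moreover have "(\<Sum>i\<in>V. b i * ((\<lambda>i\<in>V. \<theta> i - W i k * t / exp x)(k := t)) i) =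
          (\<Sum>i\<in>V. b i * \<theta> i) - (\<Sum>i\<in>V. b i * (W i k * t / exp x))"
          unfolding sum_subtractf[symmetric] using insert.hyps
          by (intro sum.cong) (auto simp: right_diff_distrib)
        ultimately show ?thesis
          using insert.hyps by (simp add: z laplace_kernel_def restore_vertex_def exp_add[symmetric] algebra_simps)
      qed
      have IH: "field_integral V \<delta> (eliminate W k (exp x)) (\<lambda>z. ennreal (laplace_kernel V a b z)) =
        ennreal (exp (- (1/2 * ?S)) * ?P)"
        by (rule insert.IH) (use connected_weights_eliminate[OF insert.prems(1) insert.hyps(2)] a_pos in auto)
      have m: "(\<lambda>z. ennreal (laplace_kernel V a b z)) \<in> borel_measurable (field_space V)" by measurable
      have "field_integral V \<delta> (eliminate W k (exp x))
          (\<lambda>z. ennreal (laplace_kernel (insert k V) a b (restore_vertex V W k x t z))) =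
        ennreal (exp (- ?p - ?q)) * ennreal (exp (- (1/2 * ?S)) * ?P)"
        unfolding split IH[symmetric] field_integral_cmult[OF insert.hyps(1) m, symmetric]
        by (simp add: ennreal_mult')
      then have "ennreal (elimination_kernel ?D x t) * field_integral V \<delta> (eliminate W k (exp x))
          (\<lambda>z. ennreal (laplace_kernel (insert k V) a b (restore_vertex V W k x t z))) =
        ennreal (elimination_kernel ?D x t * (exp (- ?p - ?q) * (exp (- (1/2 * ?S)) * ?P)))"
        using P_nonneg by (simp add: ennreal_mult'[symmetric] elimination_kernel_def)
      also have "elimination_kernel ?D x t * (exp (- ?p - ?q) * (exp (- (1/2 * ?S)) * ?P)) =
        exp (?D - exp x / 2 - (?D\<^sup>2 + t\<^sup>2) / (2 * exp x) - ?p - ?q - 1/2 * ?S) * (?P / (2 * pi))"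
      proof -
        have "exp (d - p - q - r) = exp d * (exp (- p - q) * exp (- r))" for d p q r :: real
          by (simp add: exp_add[symmetric])
        then show ?thesis by (simp add: elimination_kernel_def)
      qed
      also have "\<dots> = exp (?E + (- (a k)\<^sup>2 * exp x / 2 - ?A\<^sup>2 / (2 * exp x)
          - (t + b k * exp x - ?B)\<^sup>2 / (2 * exp x))) * (?P / (2 * pi))"
        unfolding elimination_exponent(1)[where a = a and b = b and y = "exp x" and t = t,
            OF insert.prems(1) insert.hyps(2) exp_gt_zero \<delta>] ..
      also have "\<dots> = (exp ?E * ?P / (2 * pi)) * exp (- (a k)\<^sup>2 * exp x / 2 - ?A\<^sup>2 / (2 * exp x)
          - (t + b k * exp x - ?B)\<^sup>2 / (2 * exp x))"
        by (simp only: exp_add) simp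
      finally show ?thesis unfolding ennreal_mult'[OF c_nonneg, symmetric] .
    qed
    have m: "(\<lambda>z. ennreal (laplace_kernel (insert k V) a b z)) \<in> borel_measurable (field_space (insert k V))"
      by measurable
    have "field_integral (insert k V) \<delta> W (\<lambda>z. ennreal (laplace_kernel (insert k V) a b z)) =
      (\<integral>\<^sup>+x. \<integral>\<^sup>+t. ennreal (exp ?E * ?P / (2 * pi)) *
        ennreal (exp (- (a k)\<^sup>2 * exp x / 2 - ?A\<^sup>2 / (2 * exp x) - (t + b k * exp x - ?B)\<^sup>2 / (2 * exp x)))
        \<partial>lborel \<partial>lborel)"
      unfolding field_integral_eliminate[OF insert.prems(1) insert.hyps(2) m] inner ..
    also have "\<dots> = ennreal (exp ?E * ?P / (2 * pi)) * ennreal (2 * pi * exp (- a k * ?A) / a k)"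
      by (rule nn_integral_cmult_inverse_gaussian_gaussian[OF ak A_pos])
    also have "\<dots> = ennreal (exp (?E - a k * ?A) * (\<Prod>i\<in>insert k V. 1 / a i))"
    proof -
      have *: "(exp e * p / (2 * pi)) * (2 * pi * exp (- a k * A) / a k) = exp (e - a k * A) * (1 / a k * p)"
        for e p A :: real
      proof -
        have "exp (e - a k * A) = exp e * exp (- a k * A)" by (simp add: exp_add[symmetric])
        moreover have "(x * p / (2 * pi)) * (2 * pi * y / a k) = x * y * (1 / a k * p)" for x y by simp
        ultimately show ?thesis by (simp only:)
      qed
      have "(\<Prod>i\<in>insert k V. 1 / a i) = 1 / a k * ?P" using insert.hyps by simp
      then show ?thesis unfolding ennreal_mult'[OF c_nonneg, symmetric] * by (rule ssubst) (rule refl)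
    qed
    also have "?E - a k * ?A =
      - (1/2 * (\<Sum>i\<in>insert \<delta> (insert k V). \<Sum>j\<in>insert \<delta> (insert k V). W i j * ?h i j))"
      unfolding insert_commute[of \<delta> k V] elimination_exponent(2)[where a = a and b = b and y = 1,
          OF insert.prems(1) insert.hyps(2) zero_less_one \<delta>]
      by (simp only: diff_conv_add_uminus minus_add_distrib minus_minus add_ac mult_minus_left)
    finally show ?case .
  qed
qed

text \<open>The total mass is the Laplace transform at \<open>a = 1\<close> and \<open>b = 0\<close>.\<close>

lemma field_integral_const:
  assumes W: "connected_weights V \<delta> W"
  shows "field_integral V \<delta> W (\<lambda>_. c) = c"
proof -
  have "field_integral V \<delta> W (\<lambda>z. ennreal (laplace_kernel V (\<lambda>_. 1) (\<lambda>_. 0) z)) = 1"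
    using field_integral_laplace_kernel[OF W, of "\<lambda>_. 1" "\<lambda>_. 0"] by simp
  moreover have "laplace_kernel V (\<lambda>_. 1) (\<lambda>_. 0) z = 1" for z :: "('a \<Rightarrow> real) \<times> ('a \<Rightarrow> real)"
    by (simp add: laplace_kernel_def split_beta)
  ultimately have "field_integral V \<delta> W (\<lambda>_. 1) = 1" by simp
  then show ?thesis
    using field_integral_cmult[of V "\<lambda>_. 1" \<delta> W c] W by (simp add: connected_weights_def)
qed

section \<open>Wiring a set of vertices to the distinguished vertex\<close>

abbreviation restrict_field :: "'a set \<Rightarrow> ('a \<Rightarrow> real) \<times> ('a \<Rightarrow> real) \<Rightarrow> ('a \<Rightarrow> real) \<times> ('a \<Rightarrow> real)" where
  "restrict_field V z \<equiv> (restrict (fst z) V, restrict (snd z) V)"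

lemma measurable_restrict_field:
  "V0 \<subseteq> V \<Longrightarrow> restrict_field V0 \<in> field_space V \<rightarrow>\<^sub>M field_space V0"
  by (intro measurable_Pair measurable_compose[OF measurable_fst] measurable_compose[OF measurable_snd]
      measurable_restrict_subset)

text \<open>Merging the vertices outside \<open>V0\<close> with \<open>\<delta>\<close> does not change the law of \<open>\<beta>\<close> and \<open>\<theta>\<close> on \<open>V0\<close>.
  Eliminating \<open>k \<in> V0\<close> on both sides gives the same kernel, as the total weight at \<open>k\<close> is the same,
  and weights related in the same way on \<open>V0 - {k}\<close>, as \<open>W\<^sub>i\<^sub>j + W\<^sub>i\<^sub>k W\<^sub>k\<^sub>j / y\<close> is linear in the
  weights \<open>W\<^sub>i\<^sub>j\<close>, \<open>W\<^sub>k\<^sub>j\<close> towards the merged vertices \<open>j\<close>. Once \<open>V0\<close> is exhausted, both sides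
  are total masses.\<close>

theorem field_integral_wire:
  assumes "V0 \<subseteq> V" and "connected_weights V \<delta> W" and "connected_weights V0 \<delta> W0"
    and "\<And>i j. i \<in> V0 \<Longrightarrow> j \<in> V0 \<Longrightarrow> W0 i j = W i j"
    and "\<And>i. i \<in> V0 \<Longrightarrow> W0 i \<delta> = (\<Sum>j\<in>insert \<delta> V - V0. W i j)"
    and "F \<in> borel_measurable (field_space V0)"
  shows "field_integral V \<delta> W (\<lambda>z. F (restrict_field V0 z)) = field_integral V0 \<delta> W0 F"
proof -
  have "finite V0" using assms(3) by (simp add: connected_weights_def)
  then show ?thesis using assms
  proof (induction V0 arbitrary: V W W0 F)
    case empty
    let ?c = "F (\<lambda>_. undefined, \<lambda>_. undefined)"
    have "field_integral V \<delta> W (\<lambda>z. F (restrict_field {} z)) = field_integral V \<delta> W (\<lambda>_. ?c)"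
      by (simp add: restrict_def)
    moreover have "field_integral {} \<delta> W0 F = field_integral {} \<delta> W0 (\<lambda>_. ?c)"
      by (simp add: field_integral_def beta_theta_def restrict_def)
    ultimately show ?case using empty.prems by (simp add: field_integral_const)
  next
    case (insert k V0)
    define V' where "V' = V - {k}"
    have V: "V = insert k V'" "k \<notin> V'" using insert.prems(1) by (auto simp: V'_def)
    have sub: "V0 \<subseteq> V'" using insert.prems(1) insert.hyps by (auto simp: V'_def)
    have cW: "connected_weights (insert k V') \<delta> W" using insert.prems(2) V by simp
    have fin: "finite V'" and \<delta>: "\<delta> \<notin> V'" "\<delta> \<noteq> k" using cW by (auto simp: connected_weights_def)
    have eq: "W0 i j = W i j" if "i \<in> insert k V0" "j \<in> insert k V0" for i j
      using insert.prems(4) that .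
    have out: "insert \<delta> V - insert k V0 = insert \<delta> V' - V0"
      using V \<delta> insert.hyps by auto
    have eq\<delta>: "W0 i \<delta> = (\<Sum>j\<in>insert \<delta> V' - V0. W i j)" if "i \<in> insert k V0" for i
      using insert.prems(5)[OF that] unfolding out .
    have sym0: "W0 \<delta> i = W0 i \<delta>" "W0 i i = 0" if "i \<in> insert \<delta> (insert k V0)" for i
      using insert.prems(3) that unfolding connected_weights_def by blast+
    have D: "(\<Sum>j\<in>insert \<delta> V'. W k j) = (\<Sum>j\<in>insert \<delta> V0. W0 k j)"
    proof -
      have "insert \<delta> V' = V0 \<union> (insert \<delta> V' - V0)" using sub by auto
      then have "(\<Sum>j\<in>insert \<delta> V'. W k j) = (\<Sum>j\<in>V0. W k j) + (\<Sum>j\<in>insert \<delta> V' - V0. W k j)"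
        using fin insert.hyps by (metis Diff_disjoint finite_Diff finite_insert sum.union_disjoint)
      also have "\<dots> = (\<Sum>j\<in>V0. W0 k j) + W0 k \<delta>" using eq eq\<delta> by simp
      also have "\<dots> = (\<Sum>j\<in>insert \<delta> V0. W0 k j)"
      proof -
        have "\<delta> \<notin> V0" using sub \<delta> by blast
        then show ?thesis using insert.hyps by simp
      qed
      finally show ?thesis .
    qed
    have m: "(\<lambda>z. F (restrict_field (insert k V0) z)) \<in> borel_measurable (field_space (insert k V'))"
      using sub by (intro measurable_compose[OF measurable_restrict_field insert.prems(6)]) auto
    have step: "field_integral V' \<delta> (eliminate W k (exp x))
        (\<lambda>z. F (restrict_field (insert k V0) (restore_vertex V' W k x t z))) =
      field_integral V0 \<delta> (eliminate W0 k (exp x)) (\<lambda>z. F (restore_vertex V0 W0 k x t z))" for x t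
    proof -
      have "restrict_field (insert k V0) (restore_vertex V' W k x t z) =
        restore_vertex V0 W0 k x t (restrict_field V0 z)" for z
        using sub eq by (auto simp: restore_vertex_def split_beta fun_eq_iff restrict_def)
      moreover have "field_integral V' \<delta> (eliminate W k (exp x)) (\<lambda>z. F (restore_vertex V0 W0 k x t (restrict_field V0 z))) =
        field_integral V0 \<delta> (eliminate W0 k (exp x)) (\<lambda>z. F (restore_vertex V0 W0 k x t z))"
      proof (rule insert.IH[OF sub])
        show "connected_weights V' \<delta> (eliminate W k (exp x))"
          by (rule connected_weights_eliminate[OF cW V(2)]) simp
        show "connected_weights V0 \<delta> (eliminate W0 k (exp x))"
          by (rule connected_weights_eliminate[OF insert.prems(3) insert.hyps(2)]) simp
        show "eliminate W0 k (exp x) i j = eliminate W k (exp x) i j" if "i \<in> V0" "j \<in> V0" for i j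
          using that eq by (simp add: eliminate_def)
        show "eliminate W0 k (exp x) i \<delta> = (\<Sum>j\<in>insert \<delta> V' - V0. eliminate W k (exp x) i j)" if i: "i \<in> V0" for i
        proof -
          have "(\<Sum>j\<in>insert \<delta> V' - V0. eliminate W k (exp x) i j) =
            (\<Sum>j\<in>insert \<delta> V' - V0. W i j + W i k / exp x * W k j)"
            using i by (intro sum.cong) (auto simp: eliminate_def)
          also have "\<dots> = W0 i \<delta> + W0 i k / exp x * W0 k \<delta>"
            using i eq eq\<delta> by (simp add: sum.distrib sum_distrib_left)
          finally show ?thesis using i sub \<delta> by (auto simp: eliminate_def)
        qed
        show "(\<lambda>z. F (restore_vertex V0 W0 k x t z)) \<in> borel_measurable (field_space V0)"
          by (intro measurable_compose[OF measurable_restore_vertex insert.prems(6)]) auto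
      qed
      ultimately show ?thesis by simp
    qed
    show ?case
      unfolding V(1) field_integral_eliminate[OF cW V(2) m] step D
        field_integral_eliminate[OF insert.prems(3) insert.hyps(2) insert.prems(6)] ..
  qed
qed

text \<open>Each edge corresponds to two ordered pairs.\<close>

lemma prod_on_edge_exp:
  fixes h :: "'a \<Rightarrow> 'a \<Rightarrow> real"
  assumes fin: "finite T" and E: "\<forall>e\<in>E. e \<subseteq> T \<and> card e = 2"
    and h: "\<And>i j. i \<in> T \<Longrightarrow> j \<in> T \<Longrightarrow> h i j = h j i"
  shows "(\<Prod>e\<in>E. on_edge (\<lambda>i j. exp (h i j)) e) =
    exp (1/2 * (\<Sum>i\<in>T. \<Sum>j\<in>T. if {i, j} \<in> E then h i j else 0))"
proof -
  have finE: "finite E" using E fin by (auto intro: finite_subset[of E "Pow T"])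
  let ?P = "{p \<in> T \<times> T. {fst p, snd p} \<in> E}"
  have edge: "on_edge (\<lambda>i j. exp (h i j)) e =
    exp (1/2 * (\<Sum>p\<in>{p \<in> ?P. {fst p, snd p} = e}. h (fst p) (snd p)))" if e: "e \<in> E" for e
  proof -
    obtain i j where ij: "e = {i, j}" "i \<noteq> j" using E e by (meson card_2_iff)
    then have T: "i \<in> T" "j \<in> T" using E e by auto
    have "{p \<in> ?P. {fst p, snd p} = e} = {(i, j), (j, i)}"
    proof (intro set_eqI iffI)
      fix p assume "p \<in> {p \<in> ?P. {fst p, snd p} = e}"
      then have "{fst p, snd p} = {i, j}" using ij(1) by simp
      then have "fst p = i \<and> snd p = j \<or> fst p = j \<and> snd p = i" by (simp only: doubleton_eq_iff)
      then show "p \<in> {(i, j), (j, i)}" by (cases p) auto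
    next
      fix p assume "p \<in> {(i, j), (j, i)}"
      then have p: "{fst p, snd p} = e" "p \<in> T \<times> T" using T unfolding ij(1) by auto
      show "p \<in> {p \<in> ?P. {fst p, snd p} = e}"
        by (intro CollectI conjI p) (simp only: p(1) e)
    qed
    moreover have "on_edge (\<lambda>i j. exp (h i j)) e = exp (h i j)"
      unfolding ij(1) by (rule on_edge_eq) (use h T in auto)
    ultimately show ?thesis using ij(2) h[OF T] by simp
  qed
  have "(\<Sum>i\<in>T. \<Sum>j\<in>T. if {i, j} \<in> E then h i j else 0) =
    (\<Sum>p\<in>T \<times> T. if {fst p, snd p} \<in> E then h (fst p) (snd p) else 0)"
    by (simp add: sum.cartesian_product split_beta)
  also have "\<dots> = (\<Sum>p\<in>?P. h (fst p) (snd p))"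
    using fin by (simp add: sum.inter_filter)
  also have "\<dots> = (\<Sum>e\<in>E. \<Sum>p\<in>{p \<in> ?P. {fst p, snd p} = e}. h (fst p) (snd p))"
    using fin finE by (intro sum.group[symmetric]) auto
  finally have "exp (1/2 * (\<Sum>i\<in>T. \<Sum>j\<in>T. if {i, j} \<in> E then h i j else 0)) =
    (\<Prod>e\<in>E. exp (1/2 * (\<Sum>p\<in>{p \<in> ?P. {fst p, snd p} = e}. h (fst p) (snd p))))"
    using finE by (simp add: sum_divide_distrib exp_sum)
  also have "\<dots> = (\<Prod>e\<in>E. on_edge (\<lambda>i j. exp (h i j)) e)"
    by (intro prod.cong refl edge[symmetric])
  finally show ?thesis ..
qed

lemma mu_density_eq_field_density:
  assumes graph: "finite_connected_graph (insert \<delta> V) E" and W: "edge_weights (insert \<delta> V) E W"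
    and \<delta>: "\<delta> \<notin> V"
  shows "mu_density (insert \<delta> V) \<delta> E W u s = field_density V \<delta> W u s"
proof -
  let ?T = "insert \<delta> V"
  let ?g = "\<lambda>i j. cosh (u i - u j) - 1 + 1/2 * (s i - s j)\<^sup>2 * exp (u i + u j)"
  have sym: "W i j = W j i" and zero: "{i, j} \<notin> E \<Longrightarrow> W i j = 0" if "i \<in> ?T" "j \<in> ?T" for i j
    using W that unfolding edge_weights_def by auto
  have g: "?g i j = ?g j i" for i j
    using cosh_minus[of "u i - u j"] by (simp add: power2_commute add.commute)
  have "(\<Prod>e\<in>E. on_edge (\<lambda>i j. exp (- W i j * ?g i j)) e) =
    exp (1/2 * (\<Sum>i\<in>?T. \<Sum>j\<in>?T. if {i, j} \<in> E then - W i j * ?g i j else 0))"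
  proof (rule prod_on_edge_exp)
    show "finite ?T" "\<forall>e\<in>E. e \<subseteq> ?T \<and> card e = 2" using graph by (auto simp: finite_connected_graph_def)
    show "- W i j * ?g i j = - W j i * ?g j i" if "i \<in> ?T" "j \<in> ?T" for i j
      using sym[OF that] g[of i j] by simp
  qed
  also have "(\<Sum>i\<in>?T. \<Sum>j\<in>?T. if {i, j} \<in> E then - W i j * ?g i j else 0) =
    (\<Sum>i\<in>?T. \<Sum>j\<in>?T. - (W i j * ?g i j))"
    by (intro sum.cong refl) (auto simp: zero)
  also have "1/2 * \<dots> = - energy ?T W u s"
    by (simp add: energy_def sum_negf)
  finally show ?thesis
    using \<delta> by (simp add: mu_density_def field_density_def)
qed

text \<open>A set of vertices that no positive weight leaves is closed under adjacency, hence contains \<open>\<delta>\<close>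
  once it is nonempty.\<close>

lemma connected_weights_graph:
  assumes graph: "finite_connected_graph (insert \<delta> V) E" and W: "edge_weights (insert \<delta> V) E W"
    and \<delta>: "\<delta> \<notin> V"
  shows "connected_weights V \<delta> W"
proof -
  let ?T = "insert \<delta> V" and ?r = "{(k, l). {k, l} \<in> E}"
  have E: "\<And>e. e \<in> E \<Longrightarrow> e \<subseteq> ?T \<and> card e = 2" and fin: "finite V"
    and conn: "\<And>i j. i \<in> ?T \<Longrightarrow> j \<in> ?T \<Longrightarrow> (i, j) \<in> ?r\<^sup>*"
    using graph by (auto simp: finite_connected_graph_def)
  have W': "W i j = W j i \<and> (if {i, j} \<in> E then W i j > 0 else W i j = 0)" if "i \<in> ?T" "j \<in> ?T" for i j
    using W that unfolding edge_weights_def by blast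
  have "\<exists>i\<in>U. \<exists>j\<in>?T - U. W i j > 0" if U: "U \<subseteq> V" "U \<noteq> {}" for U
  proof (rule ccontr)
    assume none: "\<not> ?thesis"
    obtain i where i: "i \<in> U" using U by blast
    have "j \<in> U" if "(i, j) \<in> ?r\<^sup>*" for j
      using that
    proof (induction rule: rtrancl_induct)
      case (step k l)
      then have e: "{k, l} \<in> E" by simp
      then have T: "k \<in> ?T" "l \<in> ?T" using E by blast+
      then have "W k l > 0" using W'[OF T] e by simp
      then show ?case using none step T by blast
    qed (rule i)
    then show False using conn[of i \<delta>] i U \<delta> by blast
  qed
  moreover have "W i i = 0" if "i \<in> ?T" for i
  proof -
    have "{i, i} \<notin> E" using E[of "{i, i}"] by auto
    then show ?thesis using W'[OF that that] by simp
  qed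
  moreover have "W i j = W j i \<and> W i j \<ge> 0" if "i \<in> ?T" "j \<in> ?T" for i j
    using W'[OF that] by (auto split: if_splits)
  ultimately show ?thesis unfolding connected_weights_def using fin \<delta> by blast
qed

lemma measurable_Omega_coordinate:
  assumes "i \<in> T"
  shows "(\<lambda>\<omega>. fst \<omega> i) \<in> borel_measurable (Omega_borel T \<delta>)" "(\<lambda>\<omega>. snd \<omega> i) \<in> borel_measurable (Omega_borel T \<delta>)"
  unfolding Omega_borel_def using assms
  by (auto intro!: measurable_restrict_space1)

lemma nn_integral_mu_measure:
  assumes graph: "finite_connected_graph (insert \<delta> V) E" and W: "edge_weights (insert \<delta> V) E W"
    and \<delta>: "\<delta> \<notin> V" and F: "F \<in> borel_measurable (field_space V)"
  shows "(\<integral>\<^sup>+\<omega>. F (beta_theta V \<delta> W (fst \<omega>) (snd \<omega>)) \<partial>mu_measure (insert \<delta> V) \<delta> E W) = field_integral V \<delta> W F"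
proof -
  let ?T = "insert \<delta> V"
  have fin: "finite V" using graph by (simp add: finite_connected_graph_def)
  have V: "?T - {\<delta>} = V" using \<delta> by auto
  have d: "(\<lambda>\<omega>. ennreal (field_density V \<delta> W (fst \<omega>) (snd \<omega>))) \<in> borel_measurable (Omega_borel ?T \<delta>)"
    by (intro measurable_compose[OF measurable_field_density measurable_ennreal] fin measurable_Omega_coordinate) auto
  have f: "(\<lambda>\<omega>. F (beta_theta V \<delta> W (fst \<omega>) (snd \<omega>))) \<in> borel_measurable (Omega_borel ?T \<delta>)"
    by (intro measurable_compose[OF measurable_beta_theta F] measurable_Omega_coordinate) auto
  have "(\<integral>\<^sup>+\<omega>. F (beta_theta V \<delta> W (fst \<omega>) (snd \<omega>)) \<partial>mu_measure ?T \<delta> E W) =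
    (\<integral>\<^sup>+\<omega>. ennreal (field_density V \<delta> W (fst \<omega>) (snd \<omega>)) * F (beta_theta V \<delta> W (fst \<omega>) (snd \<omega>)) \<partial>Omega_lebesgue ?T \<delta>)"
    unfolding mu_measure_def mu_density_eq_field_density[OF graph W \<delta>] split_beta
    by (rule nn_integral_density) (use d f in \<open>simp_all add: Omega_lebesgue_def\<close>)
  also have "\<dots> = field_integral V \<delta> W F"
    unfolding Omega_lebesgue_def field_integral_def V
    using measurable_extend_zero[of \<delta> ?T] d f
    by (subst nn_integral_distr) (simp_all add: V split_beta)
  finally show ?thesis .
qed

section \<open>Consistency of the wired approximation\<close>

lemma wired_edge_cases:
  assumes "x \<in> wired_edges Vinf E U"
  obtains e where "x = Some ` e" "e \<in> E" "e \<subseteq> U"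
  | i where "x = {Some i, None}" "i \<in> U" "\<exists>j\<in>Vinf - U. {i, j} \<in> E"
  using assms unfolding wired_edges_def by blast

lemma wired_edge_Some_iff:
  assumes "i \<in> U" "j \<in> U"
  shows "{Some i, Some j} \<in> wired_edges Vinf E U \<longleftrightarrow> {i, j} \<in> E"
proof
  assume "{Some i, Some j} \<in> wired_edges Vinf E U"
  then show "{i, j} \<in> E"
  proof (cases rule: wired_edge_cases)
    case (1 e)
    have "Some ` {i, j} = Some ` e" using 1(1) by simp
    then have "{i, j} = e" by (simp only: inj_image_eq_iff[OF inj_Some])
    then show ?thesis using 1(2) by simp
  next
    case (2 k)
    have "None \<in> {Some i, Some j}" unfolding 2(1) by simp
    then show ?thesis by simp
  qed
next
  assume "{i, j} \<in> E"
  moreover have "{Some i, Some j} = Some ` {i, j}" by simp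
  ultimately show "{Some i, Some j} \<in> wired_edges Vinf E U"
    unfolding wired_edges_def using assms by blast
qed

lemma wired_edge_None_iff:
  assumes "i \<in> U"
  shows "{Some i, None} \<in> wired_edges Vinf E U \<longleftrightarrow> (\<exists>j\<in>Vinf - U. {i, j} \<in> E)"
proof
  assume "{Some i, None} \<in> wired_edges Vinf E U"
  then show "\<exists>j\<in>Vinf - U. {i, j} \<in> E"
  proof (cases rule: wired_edge_cases)
    case (1 e)
    have "None \<in> Some ` e" unfolding 1(1)[symmetric] by simp
    then show ?thesis by blast
  next
    case (2 k)
    have "Some i \<in> {Some k, None}" unfolding 2(1)[symmetric] by simp
    then show ?thesis using 2(3) by simp
  qed
next
  assume "\<exists>j\<in>Vinf - U. {i, j} \<in> E"
  then show "{Some i, None} \<in> wired_edges Vinf E U"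
    unfolding wired_edges_def using assms by blast
qed

lemma edge_weights_wired:
  assumes W: "edge_weights Vinf E W" and U: "U \<subseteq> Vinf"
    and summable: "\<And>i. i \<in> U \<Longrightarrow> W i summable_on (Vinf - U)"
  shows "edge_weights (wired_vertices U) (wired_edges Vinf E U) (wired_weights Vinf W U)"
proof -
  have W': "W i j = W j i" "{i, j} \<in> E \<Longrightarrow> W i j > 0" "{i, j} \<notin> E \<Longrightarrow> W i j = 0"
    if "i \<in> Vinf" "j \<in> Vinf" for i j
    using W that unfolding edge_weights_def by (metis, metis, metis)
  have SN: "if {Some i, None} \<in> wired_edges Vinf E U then infsum (W i) (Vinf - U) > 0
      else infsum (W i) (Vinf - U) = 0" if i: "i \<in> U" for i
  proof (cases "\<exists>j\<in>Vinf - U. {i, j} \<in> E")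
    case True
    then obtain j where j: "j \<in> Vinf - U" "{i, j} \<in> E" by blast
    have "W i l \<ge> 0" if "l \<in> Vinf - U" for l
      using W'[of i l] i U that by (cases "{i, l} \<in> E") (auto intro: less_imp_le)
    then have "infsum (W i) {j} \<le> infsum (W i) (Vinf - U)"
      using j i by (intro infsum_mono_neutral summable) auto
    moreover have "W i j > 0" using W'(2)[of i j] i j U by auto
    ultimately show ?thesis using True i by (simp add: wired_edge_None_iff)
  next
    case False
    have "infsum (W i) (Vinf - U) = infsum (\<lambda>_. 0) (Vinf - U)"
      using W'(3)[of i] i U False by (intro infsum_cong) auto
    then show ?thesis using False i by (simp add: wired_edge_None_iff)
  qed
  have NN: "{None} \<notin> wired_edges Vinf E U"
  proof
    assume "{None} \<in> wired_edges Vinf E U"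
    then show False
    proof (cases rule: wired_edge_cases)
      case (1 e)
      have "None \<in> Some ` e" unfolding 1(1)[symmetric] by simp
      then show ?thesis by blast
    next
      case (2 k)
      have "Some k \<in> {None}" by (subst 2(1)) simp
      then show ?thesis by simp
    qed
  qed
  show ?thesis
    unfolding edge_weights_def
  proof (intro ballI)
    fix x y assume xy: "x \<in> wired_vertices U" "y \<in> wired_vertices U"
    show "wired_weights Vinf W U x y = wired_weights Vinf W U y x \<and>
      (if {x, y} \<in> wired_edges Vinf E U then wired_weights Vinf W U x y > 0 else wired_weights Vinf W U x y = 0)"
    proof (cases x)
      case None
      show ?thesis
      proof (cases y)
        case None
        with \<open>x = None\<close> NN show ?thesis by (simp add: wired_weights_def)
      next
        case (Some j)
        then have "j \<in> U" using xy by (auto simp: wired_vertices_def)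
        from SN[OF this] show ?thesis using \<open>x = None\<close> Some by (simp add: wired_weights_def insert_commute)
      qed
    next
      case (Some i)
      then have i: "i \<in> U" using xy by (auto simp: wired_vertices_def)
      show ?thesis
      proof (cases y)
        case None
        from SN[OF i] show ?thesis using \<open>x = Some i\<close> None by (simp add: wired_weights_def)
      next
        case (Some j)
        then have j: "j \<in> U" using xy by (auto simp: wired_vertices_def)
        have "i \<in> Vinf" "j \<in> Vinf" using i j U by auto
        from W'[OF this] i j show ?thesis
          using \<open>x = Some i\<close> Some by (auto simp: wired_weights_def wired_edge_Some_iff)
      qed
    qed
  qed
qed

text \<open>This is the relation between weights that \<open>field_integral_wire\<close> asks for: the weight of \<open>i\<close>
  towards the outside of \<open>U\<close> is carried partly by \<open>U' - U\<close> and partly by the outside of \<open>U'\<close>.\<close>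

lemma wired_weights_telescope:
  assumes U: "U \<subseteq> U'" "U' \<subseteq> Vinf" "finite U'" and i: "i \<in> U"
    and summable: "W i summable_on (Vinf - U')"
  shows "wired_weights Vinf W U (Some i) None =
    (\<Sum>j\<in>insert None (Some ` U') - Some ` U. wired_weights Vinf W U' (Some i) j)"
proof -
  have "insert None (Some ` U') - Some ` U = insert None (Some ` (U' - U))" by auto
  then have "(\<Sum>j\<in>insert None (Some ` U') - Some ` U. wired_weights Vinf W U' (Some i) j) =
    infsum (W i) (Vinf - U') + (\<Sum>j\<in>U' - U. W i j)"
    using U by (simp add: sum.reindex wired_weights_def)
  also have "\<dots> = infsum (W i) ((Vinf - U') \<union> (U' - U))"
    using U summable by (subst infsum_Un_disjoint) (auto intro: summable_on_finite)
  also have "(Vinf - U') \<union> (U' - U) = Vinf - U" using U by auto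
  finally show ?thesis by (simp add: wired_weights_def)
qed

lemma beta_theta_wired:
  assumes "I \<subseteq> U"
  shows "(\<lambda>i\<in>I. wired_beta Vinf W U u i, \<lambda>i\<in>I. wired_theta Vinf W U u s i) =
    (\<lambda>z. (\<lambda>i\<in>I. fst z (Some i), \<lambda>i\<in>I. snd z (Some i)))
      (beta_theta (Some ` U) None (wired_weights Vinf W U) u s)"
  using assms by (auto simp: beta_theta_def wired_beta_def wired_theta_def wired_vertices_def fun_eq_iff)

lemma wired_integrand_eq_laplace_kernel:
  "wired_integrand Vinf W U a b \<omega> =
    laplace_kernel (Some ` U) a b (beta_theta (Some ` U) None (wired_weights Vinf W U) (fst \<omega>) (snd \<omega>))"
proof -
  have "wired_vertices U - {None} = Some ` U" by (auto simp: wired_vertices_def)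
  then show ?thesis
    by (simp add: wired_integrand_def laplace_integrand_def laplace_kernel_def beta_theta_def split_beta
        wired_vertices_def)
qed

lemma measurable_relabel_field:
  "(\<lambda>z. (\<lambda>i\<in>I. fst z (Some i), \<lambda>i\<in>I. snd z (Some i))) \<in> field_space (Some ` I) \<rightarrow>\<^sub>M field_space I"
  by (intro measurable_Pair measurable_restrict measurable_compose[OF measurable_fst measurable_component_singleton]
      measurable_compose[OF measurable_snd measurable_component_singleton]) auto

lemma sets_wired_mu: "sets (wired_mu Vinf E W U) = sets (Omega_borel (wired_vertices U) None)"
  by (simp add: wired_mu_def mu_measure_def Omega_lebesgue_def)

lemma measurable_wired_beta_theta:
  "(\<lambda>\<omega>. beta_theta (Some ` U) None (wired_weights Vinf W U) (fst \<omega>) (snd \<omega>))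
     \<in> wired_mu Vinf E W U \<rightarrow>\<^sub>M field_space (Some ` U)"
proof -
  have "(\<lambda>\<omega>. beta_theta (Some ` U) None (wired_weights Vinf W U) (fst \<omega>) (snd \<omega>))
     \<in> Omega_borel (wired_vertices U) None \<rightarrow>\<^sub>M field_space (Some ` U)"
    by (intro measurable_beta_theta measurable_Omega_coordinate) (auto simp: wired_vertices_def)
  then show ?thesis by (simp cong: measurable_cong_sets add: sets_wired_mu)
qed

theorem lemma1p2:
  fixes Vinf :: "'v set" and E :: "'v set set" and W :: "'v \<Rightarrow> 'v \<Rightarrow> real"
    and V :: "nat \<Rightarrow> 'v set" and n :: nat
  assumes "infinite Vinf"
    and "\<forall>e\<in>E. \<exists>i\<in>Vinf. \<exists>j\<in>Vinf. e = {i, j}"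
    and "edge_weights Vinf E W"
    and "\<forall>m. finite (V m)"
    and "\<forall>m. V m \<subseteq> V (Suc m)"
    and "(\<Union>m. V m) = Vinf"
    and "\<forall>m. \<forall>i\<in>V m. W i summable_on (Vinf - V m)"
    and "\<forall>m. finite_connected_graph (wired_vertices (V m)) (wired_edges Vinf E (V m))"
  shows "(\<forall>(a, b) \<in> G_set (wired_vertices (V (Suc n))) None.
            (\<forall>i \<in> wired_vertices (V (Suc n)) - Some ` V n. a i = 1 \<and> b i = 0) \<longrightarrow>
            (let a' = restrict a (Some ` V n); b' = restrict b (Some ` V n) in
              integrable (wired_mu Vinf E W (V n)) (wired_integrand Vinf W (V n) a' b') \<and>
              integrable (wired_mu Vinf E W (V (Suc n))) (wired_integrand Vinf W (V (Suc n)) a b) \<and>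
              wired_laplace Vinf E W (V n) a' b' = wired_laplace Vinf E W (V (Suc n)) a b)) \<and>
         wired_law Vinf E W (V n) (V n) = wired_law Vinf E W (V (Suc n)) (V n)"
proof -
  let ?W = "\<lambda>m. wired_weights Vinf W (V m)" and ?V = "\<lambda>m. Some ` V m"
  let ?\<mu> = "\<lambda>m. wired_mu Vinf E W (V m)"
  let ?f = "\<lambda>m \<omega>. beta_theta (?V m) None (?W m) (fst \<omega>) (snd \<omega>)"
  have sub: "V m \<subseteq> Vinf" for m using assms(6) by blast
  have ew: "edge_weights (insert None (?V m)) (wired_edges Vinf E (V m)) (?W m)" for m
    using edge_weights_wired[OF assms(3) sub, of m] assms(7) by (simp add: wired_vertices_def)
  have graph: "finite_connected_graph (insert None (?V m)) (wired_edges Vinf E (V m))" for m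
    using assms(8) by (simp add: wired_vertices_def)
  have conn: "connected_weights (?V m) None (?W m)" for m
    by (rule connected_weights_graph[OF graph ew]) auto
  have expectation: "(\<integral>\<^sup>+\<omega>. F (?f m \<omega>) \<partial>?\<mu> m) = field_integral (?V m) None (?W m) F"
    if "F \<in> borel_measurable (field_space (?V m))" for F m
    unfolding wired_mu_def wired_vertices_def by (rule nn_integral_mu_measure[OF graph ew _ that]) auto
  have consistent: "(\<integral>\<^sup>+\<omega>. F (restrict_field (?V n) (?f (Suc n) \<omega>)) \<partial>?\<mu> (Suc n)) = (\<integral>\<^sup>+\<omega>. F (?f n \<omega>) \<partial>?\<mu> n)"
    if F: "F \<in> borel_measurable (field_space (?V n))" for F
  proof -
    have incl: "?V n \<subseteq> ?V (Suc n)" using assms(5) by auto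
    have "field_integral (?V (Suc n)) None (?W (Suc n)) (\<lambda>z. F (restrict_field (?V n) z)) =
      field_integral (?V n) None (?W n) F"
    proof (rule field_integral_wire[OF incl conn conn _ _ F])
      show "?W n i j = ?W (Suc n) i j" if "i \<in> ?V n" "j \<in> ?V n" for i j
        using that by (auto simp: wired_weights_def)
      show "?W n i None = (\<Sum>j\<in>insert None (?V (Suc n)) - ?V n. ?W (Suc n) i j)" if i: "i \<in> ?V n" for i
      proof -
        obtain i' where i': "i = Some i'" "i' \<in> V n" using i by auto
        have "W i' summable_on (Vinf - V (Suc n))" using assms(5,7) i'(2) by blast
        then show ?thesis
          unfolding i'(1) using assms(4,5) sub i'(2) by (intro wired_weights_telescope) auto
      qed
    qed
    then show ?thesis
      using expectation[OF F] expectation[OF measurable_compose[OF measurable_restrict_field[OF incl] F]] by simp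
  qed
  have "wired_law Vinf E W (V n) (V n) = wired_law Vinf E W (V (Suc n)) (V n)"
  proof (rule measure_eqI)
    let ?r = "\<lambda>z. (\<lambda>i\<in>V n. fst z (Some i), \<lambda>i\<in>V n. snd z (Some i)) :: ('v \<Rightarrow> real) \<times> ('v \<Rightarrow> real)"
    show "sets (wired_law Vinf E W (V n) (V n)) = sets (wired_law Vinf E W (V (Suc n)) (V n))"
      by (simp add: wired_law_def)
    fix X assume "X \<in> sets (wired_law Vinf E W (V n) (V n))"
    then have X: "X \<in> sets (field_space (V n))" by (simp add: wired_law_def)
    have law: "emeasure (wired_law Vinf E W (V m) (V n)) X = (\<integral>\<^sup>+\<omega>. indicator X (?r (?f m \<omega>)) \<partial>?\<mu> m)"
      if m: "V n \<subseteq> V m" for m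
    proof -
      have r: "(\<lambda>\<omega>. ?r (?f m \<omega>)) \<in> ?\<mu> m \<rightarrow>\<^sub>M field_space (V n)"
      proof -
        have "?r \<in> field_space (?V m) \<rightarrow>\<^sub>M field_space (V n)"
          using m by (intro measurable_Pair measurable_restrict
            measurable_compose[OF measurable_fst measurable_component_singleton]
            measurable_compose[OF measurable_snd measurable_component_singleton]) auto
        from measurable_compose[OF measurable_wired_beta_theta this] show ?thesis .
      qed
      have "wired_law Vinf E W (V m) (V n) = distr (?\<mu> m) (field_space (V n)) (\<lambda>\<omega>. ?r (?f m \<omega>))"
        unfolding wired_law_def split_beta beta_theta_wired[OF m] ..
      then have "emeasure (wired_law Vinf E W (V m) (V n)) X =
        (\<integral>\<^sup>+y. indicator X y \<partial>distr (?\<mu> m) (field_space (V n)) (\<lambda>\<omega>. ?r (?f m \<omega>)))"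
        using X by simp
      also have "\<dots> = (\<integral>\<^sup>+\<omega>. indicator X (?r (?f m \<omega>)) \<partial>?\<mu> m)"
        using X by (intro nn_integral_distr[OF r]) simp
      finally show ?thesis .
    qed
    have "?r (restrict_field (?V n) z) = ?r z" for z by (auto simp: fun_eq_iff)
    moreover have "(\<lambda>z. indicator X (?r z) :: ennreal) \<in> borel_measurable (field_space (?V n))"
      using X by (intro measurable_compose[OF measurable_relabel_field]) simp
    note consistent[OF this]
    ultimately show "emeasure (wired_law Vinf E W (V n) (V n)) X = emeasure (wired_law Vinf E W (V (Suc n)) (V n)) X"
      using law[of n] law[of "Suc n"] assms(5) by simp
  qed
  moreover have "integrable (?\<mu> n) (wired_integrand Vinf W (V n) (restrict a (?V n)) (restrict b (?V n))) \<and>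
      integrable (?\<mu> (Suc n)) (wired_integrand Vinf W (V (Suc n)) a b) \<and>
      wired_laplace Vinf E W (V n) (restrict a (?V n)) (restrict b (?V n)) = wired_laplace Vinf E W (V (Suc n)) a b"
    if ab: "(a, b) \<in> G_set (wired_vertices (V (Suc n))) None"
      and outside: "\<forall>i \<in> wired_vertices (V (Suc n)) - ?V n. a i = 1 \<and> b i = 0" for a b
  proof -
    let ?a = "restrict a (?V n)" and ?b = "restrict b (?V n)"
    let ?L = "\<lambda>z. ennreal (laplace_kernel (?V n) ?a ?b z)"
    have Lm: "(\<lambda>z. ennreal (laplace_kernel (?V m) c d z)) \<in> borel_measurable (field_space (?V m))" for m c d
      by measurable
    \<comment> \<open>A vertex with \<open>a i = 1\<close> and \<open>b i = 0\<close> contributes neither \<open>\<beta>\<^sub>i\<close> nor \<open>\<theta>\<^sub>i\<close> to the exponent.\<close>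
    have kernel: "laplace_kernel (?V (Suc n)) a b z = laplace_kernel (?V n) ?a ?b (restrict_field (?V n) z)" for z
    proof -
      have "(\<Sum>i\<in>?V (Suc n). ((a i)\<^sup>2 + (b i)\<^sup>2 - 1) * fst z i) = (\<Sum>i\<in>?V n. ((a i)\<^sup>2 + (b i)\<^sup>2 - 1) * fst z i)"
        "(\<Sum>i\<in>?V (Suc n). b i * snd z i) = (\<Sum>i\<in>?V n. b i * snd z i)"
        using assms(4,5) outside by (intro sum.mono_neutral_right; force simp: wired_vertices_def)+
      then show ?thesis by (simp add: laplace_kernel_def split_beta)
    qed
    have eq: "(\<integral>\<^sup>+\<omega>. ennreal (wired_integrand Vinf W (V (Suc n)) a b \<omega>) \<partial>?\<mu> (Suc n)) =
      (\<integral>\<^sup>+\<omega>. ennreal (wired_integrand Vinf W (V n) ?a ?b \<omega>) \<partial>?\<mu> n)"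
      using consistent[OF Lm, of ?a ?b] by (simp only: wired_integrand_eq_laplace_kernel kernel)
    have "(\<integral>\<^sup>+\<omega>. ennreal (wired_integrand Vinf W (V (Suc n)) a b \<omega>) \<partial>?\<mu> (Suc n)) =
      field_integral (?V (Suc n)) None (?W (Suc n)) (\<lambda>z. ennreal (laplace_kernel (?V (Suc n)) a b z))"
      unfolding wired_integrand_eq_laplace_kernel by (rule expectation[OF Lm])
    also have "\<dots> < \<infinity>"
      using ab by (subst field_integral_laplace_kernel[OF conn]) (auto simp: G_set_def wired_vertices_def)
    finally have fin: "(\<integral>\<^sup>+\<omega>. ennreal (wired_integrand Vinf W (V (Suc n)) a b \<omega>) \<partial>?\<mu> (Suc n)) < \<infinity>" .
    have m: "wired_integrand Vinf W (V m) c d \<in> borel_measurable (?\<mu> m)" for m c d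
      unfolding wired_integrand_eq_laplace_kernel[abs_def]
      by (rule measurable_compose[OF measurable_wired_beta_theta measurable_laplace_kernel])
    have nn: "wired_integrand Vinf W (V m) c d \<omega> \<ge> 0" for m c d \<omega>
      by (simp add: wired_integrand_eq_laplace_kernel laplace_kernel_def split_beta)
    have "wired_laplace Vinf E W (V n) ?a ?b = wired_laplace Vinf E W (V (Suc n)) a b"
      unfolding wired_laplace_def by (simp add: integral_eq_nn_integral m nn eq)
    moreover have "integrable (?\<mu> n) (wired_integrand Vinf W (V n) ?a ?b)"
      by (rule integrableI_nonneg) (use fin m nn eq in auto)
    moreover have "integrable (?\<mu> (Suc n)) (wired_integrand Vinf W (V (Suc n)) a b)"
      by (rule integrableI_nonneg) (use fin m nn in auto)
    ultimately show ?thesis by blast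
  qed
  ultimately show ?thesis by (auto simp: Let_def)
qed

end
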